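(* Let $\mathcal H$ be a complex separable Hilbert space, $\rho_0,\rho\in\tilde{\mathcal B}_1^+$, and assume that $\ln\rho-\ln\rho_0$ is a well-defined bounded operator on $\mathcal H$. Then the Bregman divergence of $\mathrm{QKL}(\cdot,\rho_0)$ with respect to the subgradient $\ln\rho-\ln\rho_0\in\partial(\mathrm{QKL}(\cdot,\rho_0))(\rho)$ is given, for all $\sigma\in\tilde{\mathcal B}_1$, by $$\Delta_{\mathrm{QKL}(\cdot,\rho_0)}^{\ln\rho-\ln\rho_0}(\sigma,\rho)=\mathrm{QKL}(\sigma,\rho).$$
   Context: $\tilde{\mathcal B}_1$ denotes the real space of self-adjoint trace-class operators on $\mathcal H$ and $\tilde{\mathcal B}_1^+$ the positive semidefinite ones. Quantum relative entropy: $\mathrm{QKL}(\rho,\rho_0):=\infty$ if $\rho\notin\tilde{\mathcal B}_1^+$ or $\rho_0\notin\tilde{\mathcal B}_1^+$ or $\ker\rho_0\not\subseteq\ker\rho$, and otherwise $\mathrm{QKL}(\rho,\rho_0):=\operatorname{tr}(\rho_0-\rho+\rho\ln\rho-\rho\ln\rho_0)$, where $\rho\ln\rho-\rho\ln\rho_0$ is defined to be zero on $\ker\rho$. The trace is understood as a value in $[0,\infty]$ in the usual (Lindblad) sense: if $(a_i)$, $(b_j)$ are orthonormal eigenbases of $\rho,\rho_0$ with eigenvalues $\lambda_i,\mu_j$, it equals $\sum_{i,j}|\langle a_i,b_j\rangle|^2(\mu_j-\lambda_i+\lambda_i\ln\lambda_i-\lambda_i\ln\mu_j)$, a sum of nonnegative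 terms, with the conventions $0\ln 0=0$, $0\ln\mu=0$, and terms with $\langle a_i,b_j\rangle=0$ being $0$. Well-definedness of $\ln\rho-\ln\rho_0$: it is treated as one single bounded operator, not as a difference of two bounded operators. It is set to $0$ on the common kernel, and $(\ln\rho-\ln\rho_0)v=(\ln\lambda-\ln\lambda_0)v$ whenever $\rho v=\lambda v$, $\rho_0v=\lambda_0v$ with $\lambda,\lambda_0>0$. Precisely: it is well-defined if $\ker\rho=\ker\rho_0=:N$ and there is a bounded self-adjoint operator $L$ on $\mathcal H$, vanishing on $N$ and mapping $N^\perp$ to itself, such that $\ln\rho=\ln\rho_0+L$ on $N^\perp$ as (possibly unbounded) self-adjoint operators; then $\ln\rho-\ln\rho_0:=L$. For a convex functional $\mathcal R:\tilde{\mathcal B}_1\to\mathbb R\cup\{\infty\}$, a point $\rho$ with $\mathcal R(\rho)<\infty$, and a bounded self-adjoint $\xi$, $\xi\in\partial\mathcal R(\rho)$ means $\mathcal R(\sigma)\ge\mathcal R(\rho)+\operatorname{tr}(\xi(\sigma-\rho))$ for all $\sigma\in\tilde{\mathcal B}_1$, and the Bregman divergence is $\Delta_{\mathcal R}^{\xi}(\sigma,\rho)=\mathcal R(\sigma)-\mathcal R(\rho)-\operatorname{tr}(\xi(\sigma-\rho))$. *)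

theory Defs
  imports "HOL-Analysis.Analysis"
begin

section \<open>Complex Hilbert spaces\<close>

text \<open>The complex inner product is conjugate-linear in its first argument. Norm, topology and
  definiteness are inherited from the underlying real inner product, which is its real part.\<close>

class complex_inner = real_inner +
  fixes scaleC :: "complex \<Rightarrow> 'a \<Rightarrow> 'a" (infixr \<open>*\<^sub>C\<close> 75)
    and cinner :: "'a \<Rightarrow> 'a \<Rightarrow> complex"
  assumes scaleC_add_right: "c *\<^sub>C (x + y) = c *\<^sub>C x + c *\<^sub>C y"
    and scaleC_add_left: "(c + d) *\<^sub>C x = c *\<^sub>C x + d *\<^sub>C x"
    and scaleC_scaleC: "c *\<^sub>C (d *\<^sub>C x) = (c * d) *\<^sub>C x"
    and scaleR_scaleC: "r *\<^sub>R x = complex_of_real r *\<^sub>C x"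
    and cinner_commute: "cinner x y = cnj (cinner y x)"
    and cinner_add_left: "cinner (x + y) z = cinner x z + cinner y z"
    and cinner_scaleC_left: "cinner (c *\<^sub>C x) y = cnj c * cinner x y"
    and inner_eq_Re_cinner: "inner x y = Re (cinner x y)"

class chilbert_space = complex_inner + complete_space

definition onb :: "'a::complex_inner set \<Rightarrow> bool" where
  "onb E \<longleftrightarrow> (\<forall>a\<in>E. \<forall>b\<in>E. cinner a b = (if a = b then 1 else 0)) \<and>
             (\<forall>x. (\<forall>a\<in>E. cinner a x = 0) \<longrightarrow> x = 0)"

definition ocompl :: "'a::complex_inner set \<Rightarrow> 'a set" where
  "ocompl N = {x. \<forall>n\<in>N. cinner n x = 0}"

section \<open>Operators\<close>

definition bounded_clinear :: "('a::complex_inner \<Rightarrow> 'a) \<Rightarrow> bool" where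
  "bounded_clinear T \<longleftrightarrow> bounded_linear T \<and> (\<forall>c x. T (c *\<^sub>C x) = c *\<^sub>C T x)"

definition bounded_selfadjoint :: "('a::complex_inner \<Rightarrow> 'a) \<Rightarrow> bool" where
  "bounded_selfadjoint T \<longleftrightarrow> bounded_clinear T \<and> (\<forall>x y. cinner (T x) y = cinner x (T y))"

definition psd :: "('a::complex_inner \<Rightarrow> 'a) \<Rightarrow> bool" where
  "psd T \<longleftrightarrow> bounded_selfadjoint T \<and> (\<forall>x. 0 \<le> Re (cinner x (T x)))"

definition kernel :: "('a::complex_inner \<Rightarrow> 'a) \<Rightarrow> 'a set" where
  "kernel T = {x. T x = 0}"

text \<open>\<open>P\<close> is the absolute value of \<open>T\<close>: it is positive and \<open>P\<^sup>2 = T\<^sup>* T\<close> (tested weakly,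
  which avoids introducing the adjoint).\<close>

definition is_abs_op :: "('a::complex_inner \<Rightarrow> 'a) \<Rightarrow> ('a \<Rightarrow> 'a) \<Rightarrow> bool" where
  "is_abs_op T P \<longleftrightarrow> psd P \<and> (\<forall>x y. cinner x (P (P y)) = cinner (T x) (T y))"

definition trace_class :: "('a::complex_inner \<Rightarrow> 'a) \<Rightarrow> bool" where
  "trace_class T \<longleftrightarrow> bounded_clinear T \<and>
     (\<exists>P E. is_abs_op T P \<and> onb E \<and> (\<lambda>e. Re (cinner e (P e))) summable_on E)"

text \<open>For a trace-class operator the sum is absolutely convergent and independent of the basis.\<close>

definition trace :: "('a::complex_inner \<Rightarrow> 'a) \<Rightarrow> complex" where
  "trace T = (\<Sum>\<^sub>\<infinity>e\<in>(SOME E. onb E). cinner e (T e))"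

definition B1 :: "('a::complex_inner \<Rightarrow> 'a) set" where
  "B1 = {T. bounded_selfadjoint T \<and> trace_class T}"

definition B1_pos :: "('a::complex_inner \<Rightarrow> 'a) set" where
  "B1_pos = {T \<in> B1. psd T}"

section \<open>Eigenbases\<close>

definition eigenbasis :: "('a::complex_inner \<Rightarrow> 'a) \<Rightarrow> 'a set \<Rightarrow> bool" where
  "eigenbasis T E \<longleftrightarrow> onb E \<and> (\<forall>e\<in>E. \<exists>r::real. T e = r *\<^sub>R e)"

definition eigval :: "('a::complex_inner \<Rightarrow> 'a) \<Rightarrow> 'a \<Rightarrow> real" where
  "eigval T e = (THE r. T e = r *\<^sub>R e)"

text \<open>An arbitrary eigenbasis. It exists for every operator in \<open>B1\<close> on a Hilbert space, and the
  notions below do not depend on the choice.\<close>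

definition some_eigenbasis :: "('a::complex_inner \<Rightarrow> 'a) \<Rightarrow> 'a set" where
  "some_eigenbasis T = (SOME E. eigenbasis T E)"

section \<open>Quantum relative entropy\<close>

text \<open>\<open>QKL_trace \<rho> \<rho>\<^sub>0\<close> is \<open>tr (\<rho>\<^sub>0 - \<rho> + \<rho> ln \<rho> - \<rho> ln \<rho>\<^sub>0)\<close> in the sense of Lindblad. The convention
  \<open>ln 0 = 0\<close> of the library covers all degenerate terms: if \<open>m = 0 < l\<close>, then
  \<open>cinner a b = 0\<close> whenever \<open>kernel \<rho>\<^sub>0 \<subseteq> kernel \<rho>\<close>. Under this inclusion (and positivity) every
  term is nonnegative, so the truncation built into \<^const>\<open>ennreal\<close> has no effect.\<close>

definition QKL_trace :: "('a::complex_inner \<Rightarrow> 'a) \<Rightarrow> ('a \<Rightarrow> 'a) \<Rightarrow> ennreal" where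
  "QKL_trace \<rho> \<rho>\<^sub>0 =
     (\<Sum>\<^sub>\<infinity>(a, b) \<in> some_eigenbasis \<rho> \<times> some_eigenbasis \<rho>\<^sub>0.
        let l = eigval \<rho> a; m = eigval \<rho>\<^sub>0 b
        in ennreal ((cmod (cinner a b))\<^sup>2 * (m - l + l * ln l - l * ln m)))"

definition QKL :: "('a::complex_inner \<Rightarrow> 'a) \<Rightarrow> ('a \<Rightarrow> 'a) \<Rightarrow> ereal" where
  "QKL \<rho> \<rho>\<^sub>0 = (if \<rho> \<in> B1_pos \<and> \<rho>\<^sub>0 \<in> B1_pos \<and> kernel \<rho>\<^sub>0 \<subseteq> kernel \<rho>
               then enn2ereal (QKL_trace \<rho> \<rho>\<^sub>0) else \<infinity>)"

section \<open>The operator logarithm and differences of logarithms\<close>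

text \<open>The (possibly unbounded) self-adjoint operator \<open>ln \<rho>\<close> on \<open>(kernel \<rho>)\<^sup>\<bottom>\<close>, given by its domain
  and its action on it through the spectral decomposition of \<open>\<rho>\<close>.\<close>

definition range_eigenbasis :: "('a::complex_inner \<Rightarrow> 'a) \<Rightarrow> 'a set" where
  "range_eigenbasis \<rho> = {a \<in> some_eigenbasis \<rho>. \<rho> a \<noteq> 0}"

definition log_dom :: "('a::complex_inner \<Rightarrow> 'a) \<Rightarrow> 'a set" where
  "log_dom \<rho> = {x \<in> ocompl (kernel \<rho>).
     (\<lambda>a. (ln (eigval \<rho> a))\<^sup>2 * (cmod (cinner a x))\<^sup>2) summable_on range_eigenbasis \<rho>}"

definition log_op :: "('a::complex_inner \<Rightarrow> 'a) \<Rightarrow> 'a \<Rightarrow> 'a" where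
  "log_op \<rho> x = (\<Sum>\<^sub>\<infinity>a\<in>range_eigenbasis \<rho>. (complex_of_real (ln (eigval \<rho> a)) * cinner a x) *\<^sub>C a)"

definition is_log_diff :: "('a::complex_inner \<Rightarrow> 'a) \<Rightarrow> ('a \<Rightarrow> 'a) \<Rightarrow> ('a \<Rightarrow> 'a) \<Rightarrow> bool" where
  "is_log_diff \<rho> \<rho>\<^sub>0 L \<longleftrightarrow>
     kernel \<rho> = kernel \<rho>\<^sub>0 \<and> bounded_selfadjoint L \<and>
     (\<forall>x\<in>kernel \<rho>. L x = 0) \<and> (\<forall>x\<in>ocompl (kernel \<rho>). L x \<in> ocompl (kernel \<rho>)) \<and>
     log_dom \<rho> = log_dom \<rho>\<^sub>0 \<and> (\<forall>x\<in>log_dom \<rho>. log_op \<rho> x = log_op \<rho>\<^sub>0 x + L x)"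

definition log_diff_well_defined :: "('a::complex_inner \<Rightarrow> 'a) \<Rightarrow> ('a \<Rightarrow> 'a) \<Rightarrow> bool" where
  "log_diff_well_defined \<rho> \<rho>\<^sub>0 \<longleftrightarrow> (\<exists>L. is_log_diff \<rho> \<rho>\<^sub>0 L)"

definition log_diff :: "('a::complex_inner \<Rightarrow> 'a) \<Rightarrow> ('a \<Rightarrow> 'a) \<Rightarrow> 'a \<Rightarrow> 'a" where
  "log_diff \<rho> \<rho>\<^sub>0 = (THE L. is_log_diff \<rho> \<rho>\<^sub>0 L)"

section \<open>Subgradients and Bregman divergence\<close>

text \<open>Functionals on \<open>B1\<close> are functions on all maps whose values outside \<open>B1\<close> are irrelevant.
  The trace of a product of two self-adjoint operators, one of them trace-class, is real, so
  taking the real part only changes the type.\<close>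

definition trace_pairing :: "('a::complex_inner \<Rightarrow> 'a) \<Rightarrow> ('a \<Rightarrow> 'a) \<Rightarrow> real" where
  "trace_pairing \<xi> \<tau> = Re (trace (\<xi> \<circ> \<tau>))"

definition subdifferential ::
    "(('a::complex_inner \<Rightarrow> 'a) \<Rightarrow> ereal) \<Rightarrow> ('a \<Rightarrow> 'a) \<Rightarrow> ('a \<Rightarrow> 'a) set" where
  "subdifferential R \<rho> = {\<xi>. \<rho> \<in> B1 \<and> R \<rho> < \<infinity> \<and> bounded_selfadjoint \<xi> \<and>
     (\<forall>\<sigma>\<in>B1. R \<sigma> \<ge> R \<rho> + ereal (trace_pairing \<xi> (\<lambda>x. \<sigma> x - \<rho> x)))}"

definition bregman ::
    "(('a::complex_inner \<Rightarrow> 'a) \<Rightarrow> ereal) \<Rightarrow> ('a \<Rightarrow> 'a) \<Rightarrow> ('a \<Rightarrow> 'a) \<Rightarrow> ('a \<Rightarrow> 'a) \<Rightarrow> ereal" where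
  "bregman R \<xi> \<sigma> \<rho> = R \<sigma> - R \<rho> - ereal (trace_pairing \<xi> (\<lambda>x. \<sigma> x - \<rho> x))"

end

theory Submission
  imports Defs
begin

text \<open>For an eigenvector \<open>s\<close> of \<open>\<sigma>\<close> with eigenvalue \<open>l\<close>, the rows of the double series for
  \<open>QKL \<sigma> \<rho>\<^sub>0\<close> and \<open>QKL \<sigma> \<rho>\<close> differ by \<open>\<langle>s, \<rho>\<^sub>0 s\<rangle> - \<langle>s, \<rho> s\<rangle> + l \<langle>s, L s\<rangle>\<close> with \<open>L = ln \<rho> - ln \<rho>\<^sub>0\<close>.
  Summing over \<open>s\<close> gives \<open>QKL \<sigma> \<rho>\<^sub>0 = QKL \<sigma> \<rho> + tr \<rho>\<^sub>0 - tr \<rho> + tr (L \<sigma>)\<close>, also when one side is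
  infinite; the value at \<open>\<sigma> = \<rho>\<close> is \<open>QKL \<rho> \<rho>\<^sub>0\<close>, and subtracting it yields the formula, while
  \<open>QKL \<sigma> \<rho> \<ge> 0\<close> is the subgradient inequality. The delicate point is that \<open>s\<close> need not lie in the
  domain of \<open>ln \<rho>\<close>, but at best in its form domain: the operator identity \<open>ln \<rho> = ln \<rho>\<^sub>0 + L\<close> has to
  be extended to quadratic forms, which is done by truncating \<open>s\<close> spectrally and using lower
  semicontinuity in both directions.\<close>

instance chilbert_space \<subseteq> banach ..

section \<open>Complex inner products\<close>

lemma mult_cnj_self: "z * cnj z = (complex_of_real (cmod z))\<^sup>2"
  using complex_norm_square[of z] by simp

lemma cinner_add_right: "cinner x (y + z) = cinner x y + cinner x z"
  by (metis cinner_add_left cinner_commute complex_cnj_add)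

lemma cinner_scaleC_right: "cinner x (c *\<^sub>C y) = c * cinner x y"
  by (metis cinner_commute cinner_scaleC_left complex_cnj_cnj complex_cnj_mult)

lemma cinner_scaleR_left: "cinner (r *\<^sub>R x) y = r * cinner x y"
  by (simp add: scaleR_scaleC cinner_scaleC_left)

lemma cinner_scaleR_right: "cinner x (r *\<^sub>R y) = r * cinner x y"
  by (simp add: scaleR_scaleC cinner_scaleC_right)

lemma scaleC_one [simp]: "1 *\<^sub>C x = x"
  using scaleR_scaleC[of 1 x] by simp

lemma cinner_self: "cinner x x = complex_of_real ((norm x)\<^sup>2)"
proof -
  have "Im (cinner x x) = 0"
    using cinner_commute[of x x] by (metis Reals_cnj_iff complex_is_Real_iff)
  moreover have "Re (cinner x x) = (norm x)\<^sup>2"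
    by (simp add: inner_eq_Re_cinner[symmetric] power2_norm_eq_inner)
  ultimately show ?thesis by (simp add: complex_eq_iff)
qed

text \<open>The norm is tied to real scalars only; homogeneity for complex scalars comes from
  evaluating the inner product of the vector with itself.\<close>

lemma norm_scaleC: "norm (c *\<^sub>C x) = cmod c * norm x"
proof -
  have "complex_of_real ((norm (c *\<^sub>C x))\<^sup>2) = complex_of_real ((cmod c * norm x)\<^sup>2)"
    unfolding cinner_self[symmetric] cinner_scaleC_left cinner_scaleC_right
    by (simp add: cinner_self power_mult_distrib mult.assoc[symmetric] mult_cnj_self mult.commute[of "cnj c"])
  then have "(norm (c *\<^sub>C x))\<^sup>2 = (cmod c * norm x)\<^sup>2"
    using of_real_eq_iff by blast
  then show ?thesis by (simp add: power2_eq_iff_nonneg)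
qed

lemma cmod_cinner_le: "cmod (cinner x y) \<le> norm x * norm y"
proof (cases "cinner x y = 0")
  case False
  \<comment> \<open>The phase of the inner product: rotating \<open>x\<close> by it makes the inner
    product real and nonnegative, so the real Cauchy-Schwarz inequality applies.\<close>
  define c where "c = sgn (cinner x y)"
  have c: "cmod c = 1" "cnj c * cinner x y = cmod (cinner x y)"
    using False by (simp_all add: c_def norm_sgn)
      (simp add: sgn_div_norm complex_norm_square[symmetric] scaleR_conv_of_real mult.assoc
        flip: power2_eq_square, simp add: mult.commute[of "cnj _"] complex_norm_square[symmetric] power2_eq_square)
  have "cmod (cinner x y) = Re (cinner (c *\<^sub>C x) y)"
    by (simp add: cinner_scaleC_left c)
  also have "\<dots> \<le> norm (c *\<^sub>C x) * norm y"
    using norm_cauchy_schwarz[of "c *\<^sub>C x" y] by (simp add: inner_eq_Re_cinner)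
  finally show ?thesis by (simp add: norm_scaleC c)
qed simp

lemma bounded_bilinear_cinner: "bounded_bilinear cinner"
proof (rule bounded_bilinear.intro)
  show "\<exists>K. \<forall>a b. cmod (cinner a b) \<le> norm a * norm b * K"
    by (rule exI[of _ 1]) (simp add: cmod_cinner_le)
qed (simp_all add: cinner_add_left cinner_add_right cinner_scaleR_left cinner_scaleR_right
      scaleR_conv_of_real)

lemma bounded_bilinear_scaleC: "bounded_bilinear (scaleC :: complex \<Rightarrow> 'a::complex_inner \<Rightarrow> 'a)"
proof (rule bounded_bilinear.intro)
  show "\<exists>K. \<forall>a b. norm (a *\<^sub>C b :: 'a) \<le> norm a * norm b * K"
    by (rule exI[of _ 1]) (simp add: norm_scaleC)
qed (simp_all add: scaleC_add_right scaleC_add_left scaleR_scaleC scaleC_scaleC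
      scaleR_conv_of_real mult.commute)

interpretation cinner: bounded_bilinear cinner by (rule bounded_bilinear_cinner)
interpretation scaleC: bounded_bilinear scaleC by (rule bounded_bilinear_scaleC)

lemma Re_cinner_le: "\<bar>Re (cinner x y)\<bar> \<le> norm x * norm y"
  using abs_Re_le_cmod[of "cinner x y"] cmod_cinner_le[of x y] by linarith

section \<open>Orthonormal sets\<close>

text \<open>The first half of \<open>onb\<close>, separated because subsets of bases and the sets in
  the Zorn argument need not be complete.\<close>

definition orthonormal :: "'a::complex_inner set \<Rightarrow> bool" where
  "orthonormal E \<longleftrightarrow> (\<forall>a\<in>E. \<forall>b\<in>E. cinner a b = (if a = b then 1 else 0))"

lemma onb_orthonormal: "onb E \<Longrightarrow> orthonormal E"
  by (simp add: onb_def orthonormal_def)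

lemma orthonormal_norm: "orthonormal E \<Longrightarrow> a \<in> E \<Longrightarrow> norm a = 1"
proof -
  assume "orthonormal E" "a \<in> E"
  then have "complex_of_real ((norm a)\<^sup>2) = of_real 1"
    using cinner_self[of a] by (simp add: orthonormal_def)
  then have "(norm a)\<^sup>2 = 1" using of_real_eq_iff by blast
  then show ?thesis by (metis norm_ge_zero power2_eq_1_iff norm_minus_cancel abs_norm_cancel abs_minus_cancel abs_1)
qed

lemma orthonormal_nonzero: "orthonormal E \<Longrightarrow> a \<in> E \<Longrightarrow> a \<noteq> 0"
  using orthonormal_norm by force

lemma cinner_orthonormal_sum:
  assumes "orthonormal E" "finite F" "F \<subseteq> E" "a \<in> E"
  shows "cinner a (\<Sum>b\<in>F. c b *\<^sub>C b) = (if a \<in> F then c a else 0)"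
proof -
  have "cinner a (\<Sum>b\<in>F. c b *\<^sub>C b) = (\<Sum>b\<in>F. if b = a then c b else 0)"
    unfolding cinner.sum_right
    using assms by (intro sum.cong) (auto simp: cinner_scaleC_right orthonormal_def)
  then show ?thesis using assms by simp
qed

lemma norm_orthonormal_sum:
  assumes "orthonormal E" "finite F" "F \<subseteq> E"
  shows "(norm (\<Sum>a\<in>F. c a *\<^sub>C a))\<^sup>2 = (\<Sum>a\<in>F. (cmod (c a))\<^sup>2)"
proof -
  have "complex_of_real ((norm (\<Sum>a\<in>F. c a *\<^sub>C a))\<^sup>2) = (\<Sum>a\<in>F. cnj (c a) * c a)"
    unfolding cinner_self[symmetric] cinner.sum_left[of _ F]
    using assms by (intro sum.cong) (auto simp: cinner_scaleC_left cinner_orthonormal_sum subset_iff)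
  also have "\<dots> = complex_of_real (\<Sum>a\<in>F. (cmod (c a))\<^sup>2)"
    by (simp add: mult_cnj_self mult.commute)
  finally show ?thesis using of_real_eq_iff by blast
qed

text \<open>The squared distance from \<open>x\<close> to its projection onto the span of
  \<open>F\<close> is nonnegative.\<close>

lemma bessel_finite:
  assumes "orthonormal E" "finite F" "F \<subseteq> E"
  shows "(\<Sum>a\<in>F. (cmod (cinner a x))\<^sup>2) \<le> (norm x)\<^sup>2"
proof -
  let ?y = "\<Sum>a\<in>F. cinner a x *\<^sub>C a"
  have *: "cinner ?y x = complex_of_real (\<Sum>a\<in>F. (cmod (cinner a x))\<^sup>2)"
    by (simp add: cinner.sum_left cinner_scaleC_left mult_cnj_self mult.commute)
  have "0 \<le> (norm (x - ?y))\<^sup>2" by simp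
  also have "\<dots> = (norm x)\<^sup>2 + (norm ?y)\<^sup>2 - 2 * inner ?y x"
    by (simp add: power2_norm_eq_inner inner_diff_left inner_diff_right inner_commute)
  also have "inner ?y x = (\<Sum>a\<in>F. (cmod (cinner a x))\<^sup>2)"
    by (simp add: inner_eq_Re_cinner *)
  finally show ?thesis using norm_orthonormal_sum[OF assms, of "\<lambda>a. cinner a x"] by simp
qed

lemma bessel_summable:
  assumes "orthonormal E"
  shows "(\<lambda>a. (cmod (cinner a x))\<^sup>2) summable_on E"
  by (rule nonneg_bdd_above_summable_on)
     (auto intro!: bdd_aboveI2[of _ _ "(norm x)\<^sup>2"] bessel_finite[OF assms])

section \<open>Unconditional convergence of orthonormal series\<close>

text \<open>Finite sets containing \<open>F0\<close> have sums close to the sum over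
  \<open>F0\<close>, so the filter of partial sums is Cauchy and converges by completeness.\<close>

lemma summable_on_CauchyI:
  fixes f :: "'b \<Rightarrow> 'a::banach"
  assumes "\<And>e. e > 0 \<Longrightarrow> \<exists>F0. finite F0 \<and> F0 \<subseteq> A \<and>
    (\<forall>F. finite F \<longrightarrow> F \<subseteq> A - F0 \<longrightarrow> norm (sum f F) < e)"
  shows "f summable_on A"
proof -
  have "\<exists>P. eventually P (finite_subsets_at_top A) \<and>
      (\<forall>F F'. P F \<and> P F' \<longrightarrow> dist (sum f F) (sum f F') < e)" if "e > 0" for e
  proof -
    obtain F0 where F0: "finite F0" "F0 \<subseteq> A"
      and small: "\<And>F. finite F \<Longrightarrow> F \<subseteq> A - F0 \<Longrightarrow> norm (sum f F) < e/2"
      using assms[OF half_gt_zero[OF \<open>e > 0\<close>]] by blast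
    define P where "P F \<longleftrightarrow> finite F \<and> F0 \<subseteq> F \<and> F \<subseteq> A" for F
    have near: "dist (sum f F) (sum f F0) < e/2" if "P F" for F
    proof -
      have "sum f F - sum f F0 = sum f (F - F0)"
        using that F0 by (simp add: P_def sum_diff)
      moreover have "norm (sum f (F - F0)) < e/2"
        using that by (intro small) (auto simp: P_def)
      ultimately show ?thesis by (simp add: dist_norm)
    qed
    have "eventually P (finite_subsets_at_top A)"
      unfolding eventually_finite_subsets_at_top P_def using F0 by blast
    moreover have "dist (sum f F) (sum f F') < e" if "P F" "P F'" for F F'
      using near[OF that(1)] near[OF that(2)] by (metis dist_triangle_half_l)
    ultimately show ?thesis by blast
  qed
  then have "cauchy_filter (filtermap (sum f) (finite_subsets_at_top A))"
    by (simp add: cauchy_filter_metric_filtermap)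
  then obtain L where "filtermap (sum f) (finite_subsets_at_top A) \<le> nhds L"
    using cauchy_filter_complete_converges[of "filtermap (sum f) (finite_subsets_at_top A)" UNIV]
      complete_UNIV
    by (auto simp: filtermap_bot_iff)
  then show ?thesis
    by (auto simp: summable_on_def has_sum_def filterlim_def)
qed

lemma summable_on_tail_small:
  fixes f :: "'b \<Rightarrow> real"
  assumes "f summable_on A" "\<And>x. x \<in> A \<Longrightarrow> f x \<ge> 0" "e > 0"
  shows "\<exists>F0. finite F0 \<and> F0 \<subseteq> A \<and> (\<forall>F. finite F \<longrightarrow> F \<subseteq> A - F0 \<longrightarrow> sum f F < e)"
proof -
  obtain F0 where F0: "finite F0" "F0 \<subseteq> A" "dist (sum f F0) (infsum f A) \<le> e/2"
    using infsum_finite_approximation[OF assms(1), of "e/2"] assms(3) by auto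
  have "sum f F < e" if "finite F" "F \<subseteq> A - F0" for F
  proof -
    have "sum f F0 + sum f F = sum f (F0 \<union> F)"
      using that F0 by (subst sum.union_disjoint) auto
    also have "\<dots> \<le> infsum f A"
      using that F0 assms by (intro finite_sum_le_infsum) auto
    finally show ?thesis using F0(3) assms(3) unfolding dist_real_def by linarith
  qed
  then show ?thesis using F0 by blast
qed

text \<open>By Pythagoras the squared norm of a finite piece of the series is a piece of the sum of
  squared coefficients, so the Cauchy criterion transfers.\<close>

lemma orthonormal_series_summable:
  fixes E :: "'a::chilbert_space set"
  assumes "orthonormal E" "(\<lambda>a. (cmod (c a))\<^sup>2) summable_on E"
  shows "(\<lambda>a. c a *\<^sub>C a) summable_on E"
proof (rule summable_on_CauchyI)
  fix e :: real assume "e > 0"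
  then obtain F0 where F0: "finite F0" "F0 \<subseteq> E"
    "\<And>F. finite F \<Longrightarrow> F \<subseteq> E - F0 \<Longrightarrow> (\<Sum>a\<in>F. (cmod (c a))\<^sup>2) < e\<^sup>2"
    using summable_on_tail_small[OF assms(2), of "e\<^sup>2"] by auto
  have "norm (\<Sum>a\<in>F. c a *\<^sub>C a) < e" if "finite F" "F \<subseteq> E - F0" for F
  proof -
    have "(norm (\<Sum>a\<in>F. c a *\<^sub>C a))\<^sup>2 < e\<^sup>2"
      using F0(3)[OF that] norm_orthonormal_sum[OF assms(1) that(1), of c] that(2)
      by (metis Diff_subset order_trans)
    then show ?thesis using \<open>e > 0\<close> by (simp add: power2_less_imp_less)
  qed
  then show "\<exists>F0. finite F0 \<and> F0 \<subseteq> E \<and>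
      (\<forall>F. finite F \<longrightarrow> F \<subseteq> E - F0 \<longrightarrow> norm (\<Sum>a\<in>F. c a *\<^sub>C a) < e)"
    using F0(1,2) by blast
qed

text \<open>Bessel makes the Fourier series converge; the difference between \<open>x\<close> and
  its sum is orthogonal to all of \<open>E\<close>, hence zero.\<close>

lemma onb_expansion:
  fixes E :: "'a::chilbert_space set"
  assumes "onb E"
  shows "((\<lambda>a. cinner a x *\<^sub>C a) has_sum x) E"
proof -
  note E = onb_orthonormal[OF assms]
  define y where "y = (\<Sum>\<^sub>\<infinity>a\<in>E. cinner a x *\<^sub>C a)"
  have y: "((\<lambda>a. cinner a x *\<^sub>C a) has_sum y) E"
    unfolding y_def using orthonormal_series_summable[OF E bessel_summable[OF E]] by simp
  have "cinner a (x - y) = 0" if "a \<in> E" for a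
  proof -
    have "((\<lambda>b. cinner a (cinner b x *\<^sub>C b)) has_sum cinner a y) E"
      using has_sum_bounded_linear[OF cinner.bounded_linear_right y] .
    moreover have "((\<lambda>b. cinner a (cinner b x *\<^sub>C b)) has_sum cinner a x) E"
      using that E by (intro has_sum_finite_neutralI[of "{a}"])
        (auto simp: cinner_scaleC_right orthonormal_def)
    ultimately show ?thesis by (simp add: cinner.diff_right has_sum_unique)
  qed
  then have "x - y = 0" using assms unfolding onb_def by blast
  then show ?thesis using y by simp
qed

lemma onb_parseval:
  fixes E :: "'a::chilbert_space set"
  assumes "onb E"
  shows "((\<lambda>a. cinner x a * cinner a y) has_sum cinner x y) E"
  using has_sum_bounded_linear[OF cinner.bounded_linear_right onb_expansion[OF assms], of x y]
  by (simp add: cinner_scaleC_right mult.commute)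

lemma cmod_cinner_commute: "cmod (cinner x y) = cmod (cinner y x)"
  by (metis cinner_commute complex_mod_cnj)

lemma cinner_mult_commute: "cinner x y * cinner y x = complex_of_real ((cmod (cinner x y))\<^sup>2)"
  by (metis cinner_commute complex_norm_square)

lemma onb_parseval_norm:
  fixes E :: "'a::chilbert_space set"
  assumes "onb E"
  shows "((\<lambda>a. (cmod (cinner a x))\<^sup>2) has_sum (norm x)\<^sup>2) E"
  using has_sum_Re[OF onb_parseval[OF assms, of x x]]
  by (simp add: cinner_mult_commute cinner_self cmod_cinner_commute[of x])

section \<open>Compact self-adjoint operators\<close>

lemma bounded_selfadjointD:
  assumes "bounded_selfadjoint T"
  shows "bounded_linear T" "T (c *\<^sub>C x) = c *\<^sub>C T x" "cinner (T x) y = cinner x (T y)"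
  using assms by (auto simp: bounded_selfadjoint_def bounded_clinear_def)

lemma bounded_clinear_expansion:
  fixes E :: "'a::chilbert_space set"
  assumes "bounded_clinear T" "onb E"
  shows "((\<lambda>e. cinner e x *\<^sub>C T e) has_sum T x) E"
  using has_sum_bounded_linear[OF _ onb_expansion[OF assms(2)], of T x] assms(1)
  by (simp add: bounded_clinear_def)

text \<open>The operator inequality P^2 <= K P, obtained without a square root of \<open>P\<close>.
  It turns summability of the diagonal of \<open>P\<close> into square summability of the norms of
  \<open>P e\<close>.\<close>

lemma psd_norm_le:
  assumes "psd P" and K: "\<And>x. norm (P x) \<le> K * norm x" "K > 0"
  shows "(norm (P x))\<^sup>2 \<le> K * Re (cinner x (P x))"
proof -
  have sa: "bounded_selfadjoint P" using assms by (simp add: psd_def)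
  interpret P: bounded_linear P using bounded_selfadjointD(1)[OF sa] .
  \<comment> \<open>the minimiser of the bound on \<open>\<langle>x - t P x, P (x - t P x)\<rangle>\<close> over \<open>t\<close>\<close>
  let ?y = "x - (1/K) *\<^sub>R P x"
  have "0 \<le> Re (cinner ?y (P ?y))" using assms(1) by (simp add: psd_def)
  also have "\<dots> = Re (cinner x (P x)) - 2 / K * (norm (P x))\<^sup>2 + (1/K)\<^sup>2 * Re (cinner (P x) (P (P x)))"
    using arg_cong[OF bounded_selfadjointD(3)[OF sa, of x "P x"], of Re]
    by (simp add: P.diff P.scaleR cinner.diff_left cinner.diff_right cinner_scaleR_left
        cinner_scaleR_right cinner_self power2_eq_square algebra_simps)
  also have "Re (cinner (P x) (P (P x))) \<le> norm (P x) * (K * norm (P x))"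
    using Re_cinner_le[of "P x" "P (P x)"] K(1)[of "P x"]
    by (smt (verit) mult_left_mono norm_ge_zero)
  finally have "2 / K * (norm (P x))\<^sup>2 \<le> Re (cinner x (P x)) + (1/K)\<^sup>2 * (norm (P x) * (K * norm (P x)))"
    using K(2) by (simp add: mult_left_mono)
  also have "(1/K)\<^sup>2 * (norm (P x) * (K * norm (P x))) = (norm (P x))\<^sup>2 / K"
    using K(2) by (simp add: power2_eq_square)
  finally show ?thesis using K(2) by (simp add: field_simps)
qed

section \<open>Trace-class operators are compact\<close>

text \<open>The operator and its absolute value have equal norms at every vector, and
  \<open>psd_norm_le\<close> bounds the latter by the summable diagonal.\<close>

lemma trace_class_hilbert_schmidt:
  assumes "trace_class T"
  obtains E where "onb E" "(\<lambda>e. (norm (T e))\<^sup>2) summable_on E"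
proof -
  obtain P E where P: "is_abs_op T P" and E: "onb E" "(\<lambda>e. Re (cinner e (P e))) summable_on E"
    using assms by (auto simp: trace_class_def)
  have psd: "psd P" using P by (simp add: is_abs_op_def)
  then have sa: "bounded_selfadjoint P" by (simp add: psd_def)
  obtain K where K: "K > 0" "\<And>x. norm (P x) \<le> K * norm x"
    using bounded_linear.pos_bounded[OF bounded_selfadjointD(1)[OF sa]] by (metis mult.commute)
  have "complex_of_real ((norm (T e))\<^sup>2) = of_real ((norm (P e))\<^sup>2)" for e
    using P by (simp add: is_abs_op_def cinner_self[symmetric] bounded_selfadjointD(3)[OF sa]
        del: of_real_power)
  then have eq: "(norm (T e))\<^sup>2 = (norm (P e))\<^sup>2" for e
    using of_real_eq_iff by blast
  have "(\<lambda>e. (norm (T e))\<^sup>2) summable_on E"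
    by (rule summable_on_comparison_test[OF summable_on_cmult_right[OF E(2), of K]])
       (auto simp: eq psd_norm_le[OF psd K(2) K(1)])
  then show ?thesis using that E(1) by blast
qed

text \<open>Each new vector contributes a compact disc, and sums of compact sets are compact. The
  set is chosen before the coefficients, which gives uniformity over the unit ball.\<close>

lemma scaleC_sums_in_compact:
  fixes v :: "'b \<Rightarrow> 'a::complex_inner"
  assumes "finite F"
  shows "\<exists>K. compact K \<and> (\<forall>c. (\<forall>e\<in>F. cmod (c e) \<le> 1) \<longrightarrow> (\<Sum>e\<in>F. c e *\<^sub>C v e) \<in> K)"
  using assms
proof induction
  case empty
  show ?case by (intro exI[of _ "{0}"]) simp
next
  case (insert e F)
  then obtain K where K: "compact K" "\<And>c. (\<forall>e\<in>F. cmod (c e) \<le> 1) \<Longrightarrow> (\<Sum>e\<in>F. c e *\<^sub>C v e) \<in> K"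
    by blast
  let ?D = "(\<lambda>z. z *\<^sub>C v e) ` cball 0 1"
  have "compact ?D"
    by (intro compact_continuous_image scaleC.continuous_on continuous_intros) simp
  then have "compact {x + y | x y. x \<in> ?D \<and> y \<in> K}"
    using K(1) by (rule compact_sums)
  moreover have "(\<Sum>e\<in>insert e F. c e *\<^sub>C v e) \<in> {x + y | x y. x \<in> ?D \<and> y \<in> K}"
    if "\<forall>e\<in>insert e F. cmod (c e) \<le> 1" for c
  proof -
    have "c e *\<^sub>C v e \<in> ?D" using that by simp
    moreover have "(\<Sum>e\<in>F. c e *\<^sub>C v e) \<in> K" using that by (intro K(2)) simp
    ultimately show ?thesis using insert.hyps by auto
  qed
  ultimately show ?case by blast
qed

lemma hilbert_schmidt_compact:
  fixes T :: "'a::chilbert_space \<Rightarrow> 'a"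
  assumes T: "bounded_clinear T" and E: "onb E" and hs: "(\<lambda>e. (norm (T e))\<^sup>2) summable_on E"
  shows "compact (closure (T ` cball 0 1))"
  unfolding compact_eq_totally_bounded
proof (intro conjI allI impI)
  show "complete (closure (T ` cball 0 1))" by (simp add: complete_eq_closed)
next
  fix \<epsilon> :: real assume "\<epsilon> > 0"
  \<comment> \<open>The budget is \<epsilon>/4 for truncating to \<open>F0\<close>, \<epsilon>/4 for
    the finite net of the truncated image, and \<epsilon>/2 for approximating a point of the
    closure.\<close>
  obtain F0 where F0: "finite F0" "F0 \<subseteq> E"
    and tail: "\<And>F. finite F \<Longrightarrow> F \<subseteq> E - F0 \<Longrightarrow> (\<Sum>e\<in>F. (norm (T e))\<^sup>2) < (\<epsilon>/4)\<^sup>2"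
    using summable_on_tail_small[OF hs, of "(\<epsilon>/4)\<^sup>2"] \<open>\<epsilon> > 0\<close> by auto
  obtain K where K: "compact K"
    "\<And>c. (\<forall>e\<in>F0. cmod (c e) \<le> 1) \<Longrightarrow> (\<Sum>e\<in>F0. c e *\<^sub>C T e) \<in> K"
    using scaleC_sums_in_compact[OF F0(1), of T] by blast
  obtain k where k: "finite k" "K \<subseteq> (\<Union>y\<in>k. ball y (\<epsilon>/4))"
    using K(1) \<open>\<epsilon> > 0\<close> unfolding compact_eq_totally_bounded by (meson zero_less_divide_iff zero_less_numeral)
  \<comment> \<open>Cauchy-Schwarz splits a finite remainder into Fourier coefficients, controlled
    by Bessel, and norms of \<open>T e\<close>, controlled by the tail. The bound then passes to the
    limit.\<close>
  have approx: "norm (T x - (\<Sum>e\<in>F0. cinner e x *\<^sub>C T e)) \<le> \<epsilon>/4" if x: "norm x \<le> 1" for x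
  proof -
    let ?g = "\<lambda>e. cinner e x *\<^sub>C T e"
    have "((\<lambda>F. norm (sum ?g F - sum ?g F0)) \<longlongrightarrow> norm (T x - sum ?g F0)) (finite_subsets_at_top E)"
      using bounded_clinear_expansion[OF T E, of x] unfolding has_sum_def by (intro tendsto_intros)
    moreover have "norm (sum ?g F - sum ?g F0) \<le> \<epsilon>/4" if F: "finite F" "F0 \<subseteq> F" "F \<subseteq> E" for F
    proof -
      have "norm (sum ?g F - sum ?g F0) = norm (sum ?g (F - F0))"
        using F F0 by (simp add: sum_diff)
      also have "\<dots> \<le> (\<Sum>e\<in>F-F0. cmod (cinner e x) * norm (T e))"
        by (rule order.trans[OF norm_sum]) (simp add: norm_scaleC)
      also have "\<dots> \<le> \<epsilon>/4"
      proof (rule power2_le_imp_le)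
        have "(\<Sum>e\<in>F-F0. cmod (cinner e x) * norm (T e))\<^sup>2
            \<le> (\<Sum>e\<in>F-F0. (cmod (cinner e x))\<^sup>2) * (\<Sum>e\<in>F-F0. (norm (T e))\<^sup>2)"
          by (rule Cauchy_Schwarz_ineq_sum)
        also have "\<dots> \<le> (norm x)\<^sup>2 * (\<epsilon>/4)\<^sup>2"
        proof (rule mult_mono)
          show "(\<Sum>e\<in>F-F0. (cmod (cinner e x))\<^sup>2) \<le> (norm x)\<^sup>2"
            using F by (intro bessel_finite[OF onb_orthonormal[OF E]]) auto
          show "(\<Sum>e\<in>F-F0. (norm (T e))\<^sup>2) \<le> (\<epsilon>/4)\<^sup>2"
            using F by (intro less_imp_le[OF tail] finite_Diff Diff_mono subset_refl)
        qed (auto intro: sum_nonneg)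
        also have "\<dots> \<le> 1 * (\<epsilon>/4)\<^sup>2"
          using x by (intro mult_right_mono) (auto simp: power_le_one)
        finally show "(\<Sum>e\<in>F-F0. cmod (cinner e x) * norm (T e))\<^sup>2 \<le> (\<epsilon>/4)\<^sup>2" by simp
      qed (use \<open>\<epsilon> > 0\<close> in simp)
      finally show ?thesis .
    qed
    then have "eventually (\<lambda>F. norm (sum ?g F - sum ?g F0) \<le> \<epsilon>/4) (finite_subsets_at_top E)"
      unfolding eventually_finite_subsets_at_top using F0 by blast
    ultimately show ?thesis by (rule tendsto_upperbound) simp
  qed
  have "\<exists>y\<in>k. z \<in> ball y \<epsilon>" if z: "z \<in> closure (T ` cball 0 1)" for z
  proof -
    obtain x where x: "norm x \<le> 1" "dist (T x) z < \<epsilon>/2"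
      using z \<open>\<epsilon> > 0\<close> unfolding closure_approachable by (force dest: spec[of _ "\<epsilon>/2"])
    let ?w = "\<Sum>e\<in>F0. cinner e x *\<^sub>C T e"
    have "cmod (cinner e x) \<le> 1" if "e \<in> F0" for e
      using cmod_cinner_le[of e x] orthonormal_norm[OF onb_orthonormal[OF E], of e] that F0 x(1) by auto
    then have "?w \<in> K" by (intro K(2)) blast
    then obtain y where y: "y \<in> k" "dist y ?w < \<epsilon>/4" using k(2) by auto
    have "dist ?w (T x) \<le> \<epsilon>/4"
      using approx[OF x(1)] by (simp add: dist_norm norm_minus_commute)
    then have "dist y z < \<epsilon>"
      using y(2) x(2) dist_triangle[of y z ?w] dist_triangle[of ?w z "T x"] by linarith
    then show ?thesis using y(1) by auto
  qed
  then show "\<exists>k. finite k \<and> closure (T ` cball 0 1) \<subseteq> (\<Union>x\<in>k. ball x \<epsilon>)"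
    using k(1) by blast
qed

section \<open>Spectral theorem for compact self-adjoint operators\<close>

text \<open>Up to sign, the norm of \<open>T\<close> on \<open>M\<close> is an eigenvalue. The
  invariant subspace is kept general so that it can be the orthogonal complement of eigenvectors
  already found.\<close>

lemma compact_selfadjoint_eigenvector:
  fixes T :: "'a::chilbert_space \<Rightarrow> 'a"
  assumes T: "bounded_selfadjoint T" and comp: "compact (closure (T ` cball 0 1))"
    and M: "closed M" "subspace M" "M \<noteq> {0}" and inv: "\<And>x. x \<in> M \<Longrightarrow> T x \<in> M"
  obtains v r where "v \<in> M" "v \<noteq> 0" "T v = r *\<^sub>R v"
proof -
  interpret T: bounded_linear T using bounded_selfadjointD(1)[OF T] .
  have symm: "inner (T x) y = inner x (T y)" for x y
    by (simp add: inner_eq_Re_cinner bounded_selfadjointD(3)[OF T])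
  define S where "S = M \<inter> sphere 0 1"
  have unit: "x /\<^sub>R norm x \<in> S" if "x \<in> M" "x \<noteq> 0" for x
    using that M(2) by (simp add: S_def subspace_scale)
  have "S \<noteq> {}" using M(2,3) unit subspace_0 by fastforce
  \<comment> \<open>The operator norm of the restriction of \<open>T\<close> to
    \<open>M\<close>.\<close>
  define m where "m = (SUP x\<in>S. norm (T x))"
  have bdd: "bdd_above ((\<lambda>x. norm (T x)) ` S)"
  proof -
    obtain K where "\<And>x. norm (T x) \<le> norm x * K" using T.bounded by blast
    then have "norm (T x) \<le> K" if "x \<in> S" for x using that by (metis S_def IntD2 mem_sphere_0 mult_1)
    then show ?thesis by (intro bdd_aboveI2)
  qed
  have le_m: "norm (T x) \<le> m * norm x" if "x \<in> M" for x
  proof (cases "x = 0")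
    case False
    have "norm (T (x /\<^sub>R norm x)) \<le> m"
      unfolding m_def by (rule cSUP_upper[OF unit[OF that False] bdd])
    then show ?thesis using False by (simp add: T.scaleR field_simps)
  qed (simp add: T.zero)
  have m0: "m \<ge> 0"
    using \<open>S \<noteq> {}\<close> bdd by (auto simp: m_def intro: cSUP_upper2)
  show ?thesis
  proof (cases "m = 0")
    case True
    obtain x where "x \<in> S" using \<open>S \<noteq> {}\<close> by blast
    then show ?thesis using le_m[of x] True by (intro that[of x 0]) (auto simp: S_def)
  next
    case False
    then have m: "m > 0" using m0 by simp
    \<comment> \<open>A maximising sequence subconverges to a unit vector \<open>z\<close> with \<open>T\<^sup>2 z = m\<^sup>2 z\<close>, and
      \<open>T\<^sup>2 - m\<^sup>2\<close> factors.\<close>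
    have "\<exists>x\<in>S. m - 1 / real (Suc n) < norm (T x)" for n
      using less_cSUP_iff[OF \<open>S \<noteq> {}\<close> bdd, of "m - 1 / real (Suc n)"] by (simp add: m_def)
    then obtain x where x: "\<And>n. x n \<in> S" "\<And>n. m - 1 / real (Suc n) < norm (T (x n))"
      by metis
    have xM: "x n \<in> M" and nx: "norm (x n) = 1" for n using x(1)[of n] by (auto simp: S_def)
    have lim_m: "(\<lambda>n. norm (T (x n))) \<longlonglongrightarrow> m"
    proof (rule tendsto_sandwich)
      show "\<forall>\<^sub>F n in sequentially. m - 1 / real (Suc n) \<le> norm (T (x n))"
        using x(2) by (intro always_eventually allI less_imp_le)
      show "\<forall>\<^sub>F n in sequentially. norm (T (x n)) \<le> m"
        using le_m[OF xM] by (simp add: nx)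
      show "(\<lambda>n. m - 1 / real (Suc n)) \<longlonglongrightarrow> m"
        using tendsto_diff[OF tendsto_const LIMSEQ_inverse_real_of_nat, of m] by (simp add: inverse_eq_divide)
    qed simp
    have "\<forall>n. T (x n) \<in> closure (T ` cball 0 1)"
      using nx closure_subset by (force simp: image_iff)
    then obtain y r where r: "strict_mono (r :: nat \<Rightarrow> nat)" "((\<lambda>n. T (x n)) \<circ> r) \<longlonglongrightarrow> y"
      using comp unfolding compact_def by metis
    define u where "u n = x (r n)" for n
    have u: "u n \<in> M" "norm (u n) = 1" for n by (simp_all add: u_def xM nx)
    have Tu: "(\<lambda>n. T (u n)) \<longlonglongrightarrow> y" using r(2) by (simp add: o_def u_def)
    have TTu: "(\<lambda>n. T (T (u n))) \<longlonglongrightarrow> T y" by (rule T.tendsto[OF Tu])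
    have Tum: "(\<lambda>n. norm (T (u n))) \<longlonglongrightarrow> m"
      using LIMSEQ_subseq_LIMSEQ[OF lim_m r(1)] by (simp add: o_def u_def)
    \<comment> \<open>Symmetry turns the cross term into the squared norm of \<open>T (u n)\<close>.
      The bound vanishes in the limit because these norms tend to \<open>m\<close>.\<close>
    have defect: "(norm (T (T (u n)) - m\<^sup>2 *\<^sub>R u n))\<^sup>2 \<le> m^4 - m\<^sup>2 * (norm (T (u n)))\<^sup>2" for n
    proof -
      have "(norm (T (T (u n)) - m\<^sup>2 *\<^sub>R u n))\<^sup>2
          = (norm (T (T (u n))))\<^sup>2 - 2 * m\<^sup>2 * (norm (T (u n)))\<^sup>2 + m^4 * (norm (u n))\<^sup>2"
      proof -
        have sq: "(norm (a - c *\<^sub>R b))\<^sup>2 = (norm a)\<^sup>2 - 2 * c * inner a b + c\<^sup>2 * (norm b)\<^sup>2" for a b :: 'a and c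
          unfolding power2_norm_eq_inner
          by (simp add: inner_diff_left inner_diff_right inner_commute algebra_simps power2_eq_square)
        show ?thesis
          using symm[of "T (u n)" "u n"] sq[of "T (T (u n))" "m\<^sup>2" "u n"]
          by (simp add: power2_norm_eq_inner)
      qed
      moreover have "(norm (T (T (u n))))\<^sup>2 \<le> (m * norm (T (u n)))\<^sup>2"
        using le_m[OF inv[OF u(1)]] by (intro power_mono) auto
      ultimately show ?thesis by (simp add: u power_mult_distrib)
    qed
    have "(\<lambda>n. (norm (T (T (u n)) - m\<^sup>2 *\<^sub>R u n))\<^sup>2) \<longlonglongrightarrow> 0"
    proof (rule tendsto_sandwich[where f="\<lambda>_. 0"])
      show "(\<lambda>n. m^4 - m\<^sup>2 * (norm (T (u n)))\<^sup>2) \<longlonglongrightarrow> 0"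
        using tendsto_diff[OF tendsto_const tendsto_mult[OF tendsto_const tendsto_power[OF Tum]], of "m^4" "m\<^sup>2" 2]
        by (simp add: power4_eq_xxxx power2_eq_square mult.assoc)
    qed (use defect in auto)
    then have D: "(\<lambda>n. T (T (u n)) - m\<^sup>2 *\<^sub>R u n) \<longlonglongrightarrow> 0"
      unfolding power_tendsto_0_iff[OF zero_less_numeral] by (rule tendsto_norm_zero_cancel)
    \<comment> \<open>Compactness only makes the images converge; since \<open>u n\<close> is
      asymptotically \<open>T (T (u n))\<close> divided by the square of \<open>m\<close>, the
      vectors themselves converge too.\<close>
    define z where "z = T y /\<^sub>R m\<^sup>2"
    have "(\<lambda>n. (T (T (u n)) - (T (T (u n)) - m\<^sup>2 *\<^sub>R u n)) /\<^sub>R m\<^sup>2) \<longlonglongrightarrow> (T y - 0) /\<^sub>R m\<^sup>2"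
      by (intro tendsto_intros TTu D)
    then have uz: "u \<longlonglongrightarrow> z" using m by (simp add: z_def)
    have zM: "z \<in> M" using closed_sequentially[OF M(1) _ uz] u(1) by blast
    have nz: "norm z = 1"
      using tendsto_norm[OF uz] u(2) by (simp add: LIMSEQ_const_iff)
    have "(\<lambda>n. T (T (u n)) - m\<^sup>2 *\<^sub>R u n) \<longlonglongrightarrow> T (T z) - m\<^sup>2 *\<^sub>R z"
      by (intro tendsto_intros T.tendsto uz)
    then have TTz: "T (T z) = m\<^sup>2 *\<^sub>R z"
      using LIMSEQ_unique[OF D] by fastforce
    show ?thesis
    \<comment> \<open>From (T - m)(T + m) z = 0: either \<open>z\<close> is an eigenvector for
      \<open>-m\<close>, or (T + m) z is one for \<open>m\<close>.\<close>
    proof (cases "T z + m *\<^sub>R z = 0")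
      case True
      then have "T z = (- m) *\<^sub>R z" by (simp add: eq_neg_iff_add_eq_0)
      moreover have "z \<noteq> 0" using nz by force
      ultimately show ?thesis using that zM by blast
    next
      case False
      have "T (T z + m *\<^sub>R z) = m *\<^sub>R (T z + m *\<^sub>R z)"
        by (simp add: T.add T.scaleR TTz scaleR_add_right power2_eq_square)
      moreover have "T z + m *\<^sub>R z \<in> M"
        using M(2) zM inv by (simp add: subspace_add subspace_scale)
      ultimately show ?thesis using that False by blast
    qed
  qed
qed

lemma orthonormal_insert:
  assumes "orthonormal E" "norm v = 1" "\<And>e. e \<in> E \<Longrightarrow> cinner e v = 0"
  shows "orthonormal (insert v E)"
  unfolding orthonormal_def
proof (intro ballI)
  have vv: "cinner v v = 1" using assms(2) by (simp add: cinner_self)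
  then have "v \<notin> E" using assms(3) by force
  moreover have "cinner v e = 0" if "e \<in> E" for e
    using assms(3)[OF that] cinner_commute[of v e] by simp
  moreover fix a b assume "a \<in> insert v E" "b \<in> insert v E"
  ultimately show "cinner a b = (if a = b then 1 else 0)"
    using vv assms(1,3) unfolding orthonormal_def by (metis insertE)
qed

text \<open>Zorn gives a maximal orthonormal set of eigenvectors. Its orthogonal complement is
  closed and invariant, so if it were nonzero it would contain a further eigenvector, contradicting
  maximality.\<close>

lemma eigenbasis_exists:
  fixes T :: "'a::chilbert_space \<Rightarrow> 'a"
  assumes "T \<in> B1"
  shows "\<exists>E. eigenbasis T E"
proof -
  have sa: "bounded_selfadjoint T" and tc: "trace_class T" using assms by (auto simp: B1_def)
  have cl: "bounded_clinear T" using sa by (simp add: bounded_selfadjoint_def)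
  have comp: "compact (closure (T ` cball 0 1))"
    using trace_class_hilbert_schmidt[OF tc] hilbert_schmidt_compact[OF cl] by metis
  define \<A> where "\<A> = {E. orthonormal E \<and> (\<forall>e\<in>E. \<exists>r::real. T e = r *\<^sub>R e)}"
  have "\<Union>C \<in> \<A>" if C: "subset.chain \<A> C" for C
  proof -
    have "cinner a b = (if a = b then 1 else 0)" if ab: "a \<in> \<Union>C" "b \<in> \<Union>C" for a b
    proof -
      obtain X Y where XY: "X \<in> C" "a \<in> X" "Y \<in> C" "b \<in> Y"
        using ab by blast
      then have "X \<subseteq> Y \<or> Y \<subseteq> X" using C unfolding subset_chain_def by blast
      then obtain X where "X \<in> C" "a \<in> X" "b \<in> X" using XY by blast
      then have "orthonormal X" using C unfolding subset_chain_def \<A>_def by blast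
      then show ?thesis using \<open>a \<in> X\<close> \<open>b \<in> X\<close> unfolding orthonormal_def by blast
    qed
    then have "orthonormal (\<Union>C)" unfolding orthonormal_def by blast
    moreover have "\<forall>e\<in>\<Union>C. \<exists>r::real. T e = r *\<^sub>R e"
      using C unfolding \<A>_def subset_chain_def by blast
    ultimately show ?thesis by (simp add: \<A>_def)
  qed
  moreover have "{} \<in> \<A>" by (simp add: \<A>_def orthonormal_def)
  ultimately obtain E where E: "E \<in> \<A>" "\<And>X. X \<in> \<A> \<Longrightarrow> E \<subseteq> X \<Longrightarrow> X = E"
    using subset_Zorn_nonempty[of \<A>] by (metis empty_iff)
  define M where "M = {x. \<forall>e\<in>E. cinner e x = 0}"
  have "M = {0}"
  proof (rule ccontr)
    assume "M \<noteq> {0}"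
    moreover have "closed M"
    proof -
      have "M = (\<Inter>e\<in>E. {x. cinner e x = 0})" by (auto simp: M_def)
      then show ?thesis
        by (auto intro!: closed_INT closed_Collect_eq cinner.continuous_on continuous_intros)
    qed
    moreover have "subspace M"
      by (auto simp: M_def subspace_def cinner.zero_right cinner_add_right cinner_scaleR_right)
    moreover have "T x \<in> M" if "x \<in> M" for x
      unfolding M_def
    proof (intro CollectI ballI)
      fix e assume "e \<in> E"
      then obtain r :: real where "T e = r *\<^sub>R e" using E(1) by (auto simp: \<A>_def)
      then have "cinner (T e) x = 0"
        using that \<open>e \<in> E\<close> by (simp add: M_def cinner_scaleR_left)
      then show "cinner e (T x) = 0" by (simp add: bounded_selfadjointD(3)[OF sa])
    qed
    ultimately obtain v r where v: "v \<in> M" "v \<noteq> 0" "T v = r *\<^sub>R v"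
      using compact_selfadjoint_eigenvector[OF sa comp] by metis
    define w where "w = v /\<^sub>R norm v"
    have w: "norm w = 1" "\<And>e. e \<in> E \<Longrightarrow> cinner e w = 0"
      using v by (auto simp: w_def M_def cinner_scaleR_right)
    have "T w = r *\<^sub>R w"
      using v(3) linear_cmul[OF bounded_linear.linear[OF bounded_selfadjointD(1)[OF sa]]]
      by (simp add: w_def)
    then have "insert w E \<in> \<A>"
      using E(1) orthonormal_insert[OF _ w] by (auto simp: \<A>_def)
    then have "w \<in> E" using E(2)[of "insert w E"] by auto
    then have "cinner w w = 0" using w(2) by blast
    then show False using w(1) by (simp add: cinner_self)
  qed
  then have "eigenbasis T E"
    using E(1) by (auto simp: eigenbasis_def onb_def \<A>_def orthonormal_def M_def)
  then show ?thesis by blast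
qed

section \<open>Eigenvalues and traces\<close>

lemma eigenbasisD: "eigenbasis T E \<Longrightarrow> onb E"
  by (simp add: eigenbasis_def)

lemma eigval_eigenbasis:
  assumes "eigenbasis T E" "e \<in> E"
  shows "T e = eigval T e *\<^sub>R e"
proof -
  obtain r :: real where r: "T e = r *\<^sub>R e" using assms by (auto simp: eigenbasis_def)
  moreover have "e \<noteq> 0"
    using orthonormal_nonzero[OF onb_orthonormal[OF eigenbasisD[OF assms(1)]] assms(2)] .
  ultimately have "eigval T e = r" unfolding eigval_def by (intro the_equality) auto
  then show ?thesis using r by simp
qed

lemma eigval_nonneg:
  assumes "psd T" "eigenbasis T E" "e \<in> E"
  shows "eigval T e \<ge> 0"
proof -
  have "norm e = 1"
    using orthonormal_norm[OF onb_orthonormal[OF eigenbasisD[OF assms(2)]] assms(3)] .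
  then have "Re (cinner e (T e)) = eigval T e"
    using eigval_eigenbasis[OF assms(2,3)] by (simp add: cinner_scaleR_right cinner_self)
  then show ?thesis using assms(1) unfolding psd_def by metis
qed

lemma some_eigenbasis:
  fixes T :: "'a::chilbert_space \<Rightarrow> 'a"
  assumes "T \<in> B1"
  shows "eigenbasis T (some_eigenbasis T)"
  unfolding some_eigenbasis_def by (rule someI_ex[OF eigenbasis_exists[OF assms]])

text \<open>Since \<open>is_abs_op\<close> prescribes only the square of \<open>P\<close>, this is
  what diagonalises \<open>P\<close> in an eigenbasis of \<open>T\<close>.\<close>

lemma is_abs_op_eigenvector:
  assumes abs: "is_abs_op T P" and T: "bounded_selfadjoint T" and a: "T a = r *\<^sub>R a"
  shows "P a = \<bar>r\<bar> *\<^sub>R a"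
proof -
  have psd: "psd P" using abs by (simp add: is_abs_op_def)
  then have P: "bounded_selfadjoint P" by (simp add: psd_def)
  interpret T: bounded_linear T using bounded_selfadjointD(1)[OF T] .
  interpret P: bounded_linear P using bounded_selfadjointD(1)[OF P] .
  have "cinner x (P (P a) - T (T a)) = 0" for x
    using abs by (simp add: is_abs_op_def cinner.diff_right bounded_selfadjointD(3)[OF T])
  from this[of "P (P a) - T (T a)"] have "P (P a) = T (T a)"
    by (simp add: cinner_self)
  then have PPa: "P (P a) = (\<bar>r\<bar> * \<bar>r\<bar>) *\<^sub>R a" by (simp add: a T.scaleR)
  \<comment> \<open>\<open>(P + \<bar>r\<bar>) v = (P\<^sup>2 - r\<^sup>2) a = 0\<close>, and \<open>P + \<bar>r\<bar>\<close> is injective unless \<open>r = 0\<close>\<close>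
  define v where "v = P a - \<bar>r\<bar> *\<^sub>R a"
  show ?thesis
  proof (cases "r = 0")
    case True
    then have "cinner (P a) (P a) = 0"
      using PPa bounded_selfadjointD(3)[OF P, of a "P a"] by (simp add: cinner.zero_right)
    then show ?thesis using True by (simp add: cinner_self)
  next
    case False
    have "P v = - \<bar>r\<bar> *\<^sub>R v"
      by (simp add: v_def P.diff P.scaleR PPa scaleR_diff_right)
    then have "Re (cinner v (P v)) = - (\<bar>r\<bar> * (norm v)\<^sup>2)"
      by (simp add: cinner_scaleR_right cinner_self cinner.minus_right)
    moreover have "Re (cinner v (P v)) \<ge> 0" using psd by (simp add: psd_def)
    moreover have "\<bar>r\<bar> * (norm v)\<^sup>2 \<ge> 0" by simp
    ultimately have "\<bar>r\<bar> * (norm v)\<^sup>2 = 0" by linarith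
    then show ?thesis using False by (simp add: v_def)
  qed
qed

lemma selfadjoint_form_has_sum:
  fixes T :: "'a::chilbert_space \<Rightarrow> 'a"
  assumes T: "bounded_clinear T" and A: "onb A" and ev: "\<And>a. a \<in> A \<Longrightarrow> T a = r a *\<^sub>R a"
  shows "((\<lambda>a. r a * (cmod (cinner a x))\<^sup>2) has_sum Re (cinner x (T x))) A"
proof -
  have "((\<lambda>a. Re (cinner x (cinner a x *\<^sub>C T a))) has_sum Re (cinner x (T x))) A"
    by (intro has_sum_Re has_sum_bounded_linear[OF cinner.bounded_linear_right]
        bounded_clinear_expansion T A)
  moreover have "Re (cinner x (cinner a x *\<^sub>C T a)) = r a * (cmod (cinner a x))\<^sup>2" if "a \<in> A" for a
  proof -
    have "cinner x (cinner a x *\<^sub>C T a) = r a * (cinner a x * cinner x a)"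
      by (simp add: ev[OF that] cinner_scaleC_right cinner_scaleR_right)
    then show ?thesis unfolding cinner_mult_commute by simp
  qed
  ultimately show ?thesis by (simp cong: has_sum_cong)
qed

text \<open>The nonnegative double family \<open>f\<close> sums over \<open>a\<close> to the
  diagonal of the absolute value in the basis \<open>E\<close>, and over \<open>e\<close>, by
  Parseval, to the absolute eigenvalues. Exchanging the order moves summability from one basis to
  the other.\<close>

lemma eigval_abs_summable:
  fixes T :: "'a::chilbert_space \<Rightarrow> 'a"
  assumes "T \<in> B1" "eigenbasis T A"
  shows "(\<lambda>a. \<bar>eigval T a\<bar>) summable_on A"
proof -
  have T: "bounded_selfadjoint T" using assms by (simp add: B1_def)
  obtain P E where P: "is_abs_op T P" and E: "onb E" "(\<lambda>e. Re (cinner e (P e))) summable_on E"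
    using assms(1) by (auto simp: B1_def trace_class_def)
  have Pcl: "bounded_clinear P"
    using P by (simp add: is_abs_op_def psd_def bounded_selfadjoint_def)
  have A: "onb A" by (rule eigenbasisD[OF assms(2)])
  define f where "f = (\<lambda>(e, a). \<bar>eigval T a\<bar> * (cmod (cinner a e))\<^sup>2)"
  have "((\<lambda>a. f (e, a)) has_sum Re (cinner e (P e))) A" for e
    unfolding f_def split
    by (rule selfadjoint_form_has_sum[OF Pcl A])
       (rule is_abs_op_eigenvector[OF P T eigval_eigenbasis[OF assms(2)]])
  then have "f summable_on E \<times> A"
    by (rule summable_on_SigmaI[OF _ E(2)]) (auto simp: f_def)
  then have "(\<lambda>(a, e). f (e, a)) summable_on A \<times> E"
    by (subst summable_on_swap[symmetric])
  then obtain S where S: "((\<lambda>(a, e). f (e, a)) has_sum S) (A \<times> E)"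
    by (auto simp: summable_on_def)
  have "((\<lambda>e. \<bar>eigval T a\<bar> * (cmod (cinner a e))\<^sup>2) has_sum \<bar>eigval T a\<bar>) E" if "a \<in> A" for a
    using has_sum_cmult_right[OF onb_parseval_norm[OF E(1), of a], of "\<bar>eigval T a\<bar>"]
      orthonormal_norm[OF onb_orthonormal[OF A] that]
    by (simp add: cmod_cinner_commute[of _ a])
  then have "((\<lambda>a. \<bar>eigval T a\<bar>) has_sum S) A"
    by (intro has_sum_SigmaD[OF S]) (simp add: f_def)
  then show ?thesis by (rule has_sum_imp_summable)
qed

text \<open>Basis independence of the trace of \<open>L\<close> after \<sigma>: a single absolutely
  summable double family has both series as its iterated sums. The shared \<open>t\<close> records
  that the two values agree.\<close>

lemma trace_class_product_has_sum:
  fixes \<sigma> :: "'a::chilbert_space \<Rightarrow> 'a"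
  assumes \<sigma>: "\<sigma> \<in> B1" "eigenbasis \<sigma> S" and L: "bounded_clinear L" and E: "onb E"
  shows "\<exists>t. ((\<lambda>s. eigval \<sigma> s * cinner s (L s)) has_sum t) S \<and>
    ((\<lambda>e. cinner e (L (\<sigma> e))) has_sum t) E"
proof -
  have S: "onb S" by (rule eigenbasisD[OF \<sigma>(2)])
  have \<sigma>cl: "bounded_clinear \<sigma>" using \<sigma> by (simp add: B1_def bounded_selfadjoint_def)
  have bl: "bounded_linear L" and hom: "\<And>c x. L (c *\<^sub>C x) = c *\<^sub>C L x"
    using L by (auto simp: bounded_clinear_def)
  obtain K where K: "\<And>x. norm (L x) \<le> norm x * K"
    using bounded_linear.bounded[OF bl] by blast
  define f where "f = (\<lambda>(s, e). complex_of_real (eigval \<sigma> s) * (cinner s e * cinner e (L s)))"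
  \<comment> \<open>A majorant of \<open>f\<close>, as a product is at most the sum of the squares;
    Parseval evaluates its rows.\<close>
  define g where "g = (\<lambda>(s, e). \<bar>eigval \<sigma> s\<bar> * ((cmod (cinner e s))\<^sup>2 + (cmod (cinner e (L s)))\<^sup>2))"
  have "g summable_on S \<times> E"
  proof (rule summable_on_SigmaI)
    show "((\<lambda>e. g (s, e)) has_sum \<bar>eigval \<sigma> s\<bar> * ((norm s)\<^sup>2 + (norm (L s))\<^sup>2)) E" for s
      unfolding g_def split
      by (intro has_sum_cmult_right has_sum_add onb_parseval_norm E)
    show "(\<lambda>s. \<bar>eigval \<sigma> s\<bar> * ((norm s)\<^sup>2 + (norm (L s))\<^sup>2)) summable_on S"
    proof (rule summable_on_comparison_test)
      show "(\<lambda>s. \<bar>eigval \<sigma> s\<bar> * (1 + K\<^sup>2)) summable_on S"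
        by (intro summable_on_cmult_left eigval_abs_summable[OF \<sigma>])
      show "\<bar>eigval \<sigma> s\<bar> * ((norm s)\<^sup>2 + (norm (L s))\<^sup>2) \<le> \<bar>eigval \<sigma> s\<bar> * (1 + K\<^sup>2)" if "s \<in> S" for s
      proof -
        have "norm s = 1" by (rule orthonormal_norm[OF onb_orthonormal[OF S] that])
        moreover have "(norm (L s))\<^sup>2 \<le> K\<^sup>2"
          using K[of s] \<open>norm s = 1\<close> by (intro power_mono) auto
        ultimately show ?thesis by (intro mult_left_mono) auto
      qed
    qed auto
  qed (auto simp: g_def)
  moreover have "norm (f p) \<le> g p" for p
  proof (cases p)
    case (Pair s e)
    have "cmod (cinner s e) * cmod (cinner e (L s)) \<le> (cmod (cinner e s))\<^sup>2 + (cmod (cinner e (L s)))\<^sup>2"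
      using sum_squares_bound[of "cmod (cinner s e)" "cmod (cinner e (L s))"]
        mult_nonneg_nonneg[OF norm_ge_zero[of "cinner s e"] norm_ge_zero[of "cinner e (L s)"]]
      unfolding cmod_cinner_commute[of e s] mult.assoc by linarith
    then show ?thesis by (simp add: Pair f_def g_def norm_mult mult_left_mono)
  qed
  ultimately have "f summable_on S \<times> E"
    by (rule abs_summable_summable[OF Infinite_Sum.abs_summable_on_comparison_test'])
  then obtain t where t: "(f has_sum t) (S \<times> E)" by (auto simp: summable_on_def)
  have "((\<lambda>s. eigval \<sigma> s * cinner s (L s)) has_sum t) S"
    by (rule has_sum_SigmaD[OF t])
       (auto simp: f_def intro!: has_sum_cmult_right onb_parseval E)
  moreover have "((\<lambda>e. cinner e (L (\<sigma> e))) has_sum t) E"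
  proof (rule has_sum_SigmaD)
    show "((\<lambda>(e, s). f (s, e)) has_sum t) (E \<times> S)" using t by (subst (asm) has_sum_swap)
    fix e
    have "((\<lambda>s. cinner e (L (cinner s e *\<^sub>C \<sigma> s))) has_sum cinner e (L (\<sigma> e))) S"
      by (intro has_sum_bounded_linear[OF cinner.bounded_linear_right] has_sum_bounded_linear[OF bl]
          bounded_clinear_expansion \<sigma>cl S)
    moreover have "cinner e (L (cinner s e *\<^sub>C \<sigma> s)) = f (s, e)" if "s \<in> S" for s
      using eigval_eigenbasis[OF \<sigma>(2) that]
      by (simp add: f_def hom cinner_scaleC_right scaleR_scaleC mult.commute mult.left_commute)
    ultimately show "((\<lambda>s. (\<lambda>(e, s). f (s, e)) (e, s)) has_sum cinner e (L (\<sigma> e))) S"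
      by (simp cong: has_sum_cong)
  qed
  ultimately show ?thesis by blast
qed

section \<open>Differences of logarithms\<close>

lemma has_sum_diff:
  fixes f g :: "'b \<Rightarrow> 'c::topological_ab_group_add"
  assumes "(f has_sum a) A" "(g has_sum b) A"
  shows "((\<lambda>x. f x - g x) has_sum a - b) A"
  using has_sum_add[OF assms(1), of "\<lambda>x. - g x" "- b"] assms(2) by (simp add: has_sum_uminus)

lemma B1_posD:
  assumes "T \<in> B1_pos"
  shows "T \<in> B1" "psd T" "bounded_selfadjoint T" "bounded_clinear T"
  using assms by (auto simp: B1_pos_def psd_def bounded_selfadjoint_def)

lemma range_eigenbasis_subset: "range_eigenbasis T \<subseteq> some_eigenbasis T"
  by (auto simp: range_eigenbasis_def)

lemma eigvec_in_ocompl_kernel: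
  assumes "bounded_selfadjoint T" "T a = r *\<^sub>R a" "r \<noteq> 0"
  shows "a \<in> ocompl (kernel T)"
proof -
  have "cinner n a = 0" if "T n = 0" for n
    using bounded_selfadjointD(3)[OF assms(1), of n a] that assms(2,3)
    by (simp add: cinner_scaleR_right cinner.zero_left)
  then show ?thesis by (simp add: ocompl_def kernel_def)
qed

lemma cinner_some_eigenbasis_ocompl:
  assumes "x \<in> ocompl (kernel T)" "a \<in> some_eigenbasis T - range_eigenbasis T"
  shows "cinner a x = 0"
  using assms by (auto simp: range_eigenbasis_def ocompl_def kernel_def)

lemma log_op_form_has_sum:
  fixes T :: "'a::chilbert_space \<Rightarrow> 'a"
  assumes T: "T \<in> B1" and x: "x \<in> log_dom T"
  shows "((\<lambda>a. ln (eigval T a) * (cmod (cinner a x))\<^sup>2) has_sum Re (cinner x (log_op T x)))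
    (some_eigenbasis T)"
proof -
  let ?R = "range_eigenbasis T"
  have on: "orthonormal ?R"
    using onb_orthonormal[OF eigenbasisD[OF some_eigenbasis[OF T]]] range_eigenbasis_subset[of T]
    unfolding orthonormal_def by blast
  have x': "x \<in> ocompl (kernel T)"
    "(\<lambda>a. (ln (eigval T a))\<^sup>2 * (cmod (cinner a x))\<^sup>2) summable_on ?R"
    using x by (auto simp: log_dom_def)
  have "(\<lambda>a. (complex_of_real (ln (eigval T a)) * cinner a x) *\<^sub>C a) summable_on ?R"
    using x'(2) by (intro orthonormal_series_summable[OF on]) (simp add: norm_mult power_mult_distrib)
  then have "((\<lambda>a. (complex_of_real (ln (eigval T a)) * cinner a x) *\<^sub>C a) has_sum log_op T x) ?R"
    by (simp add: log_op_def)
  then have "((\<lambda>a. Re (cinner x ((complex_of_real (ln (eigval T a)) * cinner a x) *\<^sub>C a)))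
      has_sum Re (cinner x (log_op T x))) ?R"
    by (intro has_sum_Re has_sum_bounded_linear[OF cinner.bounded_linear_right])
  moreover have "Re (cinner x ((complex_of_real (ln (eigval T a)) * cinner a x) *\<^sub>C a))
      = ln (eigval T a) * (cmod (cinner a x))\<^sup>2" for a
    unfolding cinner_scaleC_right mult.assoc cinner_mult_commute by simp
  ultimately have "((\<lambda>a. ln (eigval T a) * (cmod (cinner a x))\<^sup>2) has_sum Re (cinner x (log_op T x))) ?R"
    by simp
  \<comment> \<open>Eigenvectors in the kernel add nothing, because \<open>x\<close> is orthogonal
    to the kernel.\<close>
  then show ?thesis
    by (rule has_sum_cong_neutral[THEN iffD1, rotated -1])
       (use range_eigenbasis_subset[of T] cinner_some_eigenbasis_ocompl[OF x'(1)] in auto)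
qed

lemma range_eigenbasis_ocompl:
  fixes T :: "'a::chilbert_space \<Rightarrow> 'a"
  assumes "T \<in> B1" "a \<in> range_eigenbasis T"
  shows "a \<in> ocompl (kernel T)"
proof (rule eigvec_in_ocompl_kernel)
  show "bounded_selfadjoint T" using assms by (simp add: B1_def)
  show *: "T a = eigval T a *\<^sub>R a"
    using assms by (intro eigval_eigenbasis[OF some_eigenbasis]) (auto simp: range_eigenbasis_def)
  show "eigval T a \<noteq> 0" using * assms(2) by (auto simp: range_eigenbasis_def)
qed

text \<open>Only finitely many coefficients are nonzero, so the domain condition is automatic. These
  are the truncations on which the operator identity for logarithms is used.\<close>

lemma finite_sum_log_dom:
  fixes T :: "'a::chilbert_space \<Rightarrow> 'a" and c :: "'a \<Rightarrow> complex"
  assumes T: "T \<in> B1" and G: "finite G" "G \<subseteq> range_eigenbasis T"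
  defines "x \<equiv> \<Sum>a\<in>G. c a *\<^sub>C a"
  shows "x \<in> log_dom T"
    and "Re (cinner x (log_op T x)) = (\<Sum>a\<in>G. ln (eigval T a) * (cmod (c a))\<^sup>2)"
proof -
  let ?A = "some_eigenbasis T"
  have on: "orthonormal ?A" by (rule onb_orthonormal[OF eigenbasisD[OF some_eigenbasis[OF T]]])
  have GA: "G \<subseteq> ?A" using G range_eigenbasis_subset by blast
  have coef: "cinner a x = (if a \<in> G then c a else 0)" if "a \<in> ?A" for a
    unfolding x_def by (rule cinner_orthonormal_sum[OF on G(1) GA that])
  have "cinner n x = 0" if "n \<in> kernel T" for n
    using range_eigenbasis_ocompl[OF T] G(2) that
    by (auto simp: x_def cinner.sum_right cinner_scaleC_right ocompl_def intro!: sum.neutral)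
  moreover have "(\<lambda>a. (ln (eigval T a))\<^sup>2 * (cmod (cinner a x))\<^sup>2) summable_on range_eigenbasis T"
  proof (rule finite_nonzero_values_imp_summable_on)
    have "a \<in> G" if "a \<in> range_eigenbasis T" "cinner a x \<noteq> 0" for a
    proof -
      have "a \<in> ?A" using that(1) range_eigenbasis_subset by blast
      then show ?thesis using coef[of a] that(2) by metis
    qed
    then show "finite {a \<in> range_eigenbasis T. (ln (eigval T a))\<^sup>2 * (cmod (cinner a x))\<^sup>2 \<noteq> 0}"
      by (intro finite_subset[OF _ G(1)]) auto
  qed
  ultimately show dom: "x \<in> log_dom T" by (simp add: log_dom_def ocompl_def)
  have "((\<lambda>a. ln (eigval T a) * (cmod (cinner a x))\<^sup>2) has_sum (\<Sum>a\<in>G. ln (eigval T a) * (cmod (c a))\<^sup>2)) ?A"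
  proof (rule has_sum_finite_neutralI[OF G(1) GA])
    show "(\<Sum>a\<in>G. ln (eigval T a) * (cmod (c a))\<^sup>2) = (\<Sum>a\<in>G. ln (eigval T a) * (cmod (cinner a x))\<^sup>2)"
      using coef GA by (intro sum.cong) auto
  qed (use coef in auto)
  then show "Re (cinner x (log_op T x)) = (\<Sum>a\<in>G. ln (eigval T a) * (cmod (c a))\<^sup>2)"
    using log_op_form_has_sum[OF T dom] has_sum_unique by blast
qed

lemma is_log_diff_swap:
  assumes "is_log_diff \<rho> \<rho>\<^sub>0 L"
  shows "is_log_diff \<rho>\<^sub>0 \<rho> (\<lambda>x. - L x)"
proof -
  have L: "bounded_selfadjoint L" using assms by (simp add: is_log_diff_def)
  have "(-1) *\<^sub>C x = - x" for x :: 'a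
    using scaleR_scaleC[of "-1" x] by simp
  then have neg: "c *\<^sub>C (- x) = - (c *\<^sub>C x)" for c and x :: 'a
    by (metis scaleC.minus_right)
  have "bounded_selfadjoint (\<lambda>x. - L x)"
    using L bounded_linear_minus[of L]
    by (auto simp: bounded_selfadjoint_def bounded_clinear_def neg cinner.minus_left cinner.minus_right)
  then show ?thesis
    using assms by (auto simp: is_log_diff_def ocompl_def cinner.minus_right)
qed

section \<open>The logarithms as quadratic forms\<close>

lemma ln_eigval_bdd_above:
  assumes "psd T" "eigenbasis T A"
  shows "\<exists>c\<ge>0. \<forall>a\<in>A. ln (eigval T a) \<le> c"
proof -
  obtain K where K: "\<And>x. norm (T x) \<le> norm x * K"
    using assms(1) bounded_linear.bounded[OF bounded_selfadjointD(1)] unfolding psd_def by blast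
  \<comment> \<open>The maximum with 1 makes \<open>ln K'\<close> nonnegative, which also covers
    zero eigenvalues, where \<open>ln\<close> takes the default value 0.\<close>
  define K' where "K' = max K 1"
  have "ln (eigval T a) \<le> ln K'" if "a \<in> A" for a
  proof (cases "eigval T a > 0")
    case True
    have "norm a = 1"
      using orthonormal_norm[OF onb_orthonormal[OF eigenbasisD[OF assms(2)]] that] .
    then have "eigval T a \<le> K'"
      using K[of a] eigval_eigenbasis[OF assms(2) that] by (simp add: K'_def)
    then show ?thesis using True by simp
  next
    case False
    then have "eigval T a = 0" using eigval_nonneg[OF assms that] by simp
    then show ?thesis by (simp add: K'_def)
  qed
  moreover have "ln K' \<ge> 0" by (simp add: K'_def)
  ultimately show ?thesis by blast
qed

text \<open>The finite spectral truncations \<open>y G\<close> of \<open>x\<close> lie in the common domain of the logarithms, where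
  the operator identity applies; bounding finite partial sums of the nonnegative form of
  \<open>c - ln \<rho>\<^sub>0\<close> and letting \<open>y G\<close> tend to \<open>x\<close> gives one inequality. The reverse one comes from
  exchanging \<open>\<rho>\<close> and \<open>\<rho>\<^sub>0\<close>, which turns \<open>L\<close> into \<open>- L\<close>.\<close>

lemma log_form_lower_bound:
  fixes \<rho> \<rho>\<^sub>0 :: "'a::chilbert_space \<Rightarrow> 'a"
  assumes \<rho>: "\<rho> \<in> B1_pos" and \<rho>0: "\<rho>\<^sub>0 \<in> B1_pos" and L: "is_log_diff \<rho> \<rho>\<^sub>0 L"
    and x: "x \<in> ocompl (kernel \<rho>)"
    and q: "((\<lambda>a. ln (eigval \<rho> a) * (cmod (cinner a x))\<^sup>2) has_sum q) (some_eigenbasis \<rho>)"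
  obtains q' where
    "((\<lambda>b. ln (eigval \<rho>\<^sub>0 b) * (cmod (cinner b x))\<^sup>2) has_sum q') (some_eigenbasis \<rho>\<^sub>0)"
    "q - Re (cinner x (L x)) \<le> q'"
proof -
  let ?A = "some_eigenbasis \<rho>" and ?B = "some_eigenbasis \<rho>\<^sub>0" and ?R = "range_eigenbasis \<rho>"
  note \<rho>' = B1_posD[OF \<rho>] and \<rho>0' = B1_posD[OF \<rho>0]
  note A = some_eigenbasis[OF \<rho>'(1)] and B = some_eigenbasis[OF \<rho>0'(1)]
  have bL: "bounded_linear L"
    using L by (auto simp: is_log_diff_def bounded_selfadjoint_def bounded_clinear_def)
  obtain c where c: "\<And>b. b \<in> ?B \<Longrightarrow> ln (eigval \<rho>\<^sub>0 b) \<le> c" "c \<ge> 0"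
    using ln_eigval_bdd_above[OF \<rho>0'(2) B] by blast
  define y where "y G = (\<Sum>a\<in>G. cinner a x *\<^sub>C a)" for G
  define h where "h z b = (c - ln (eigval \<rho>\<^sub>0 b)) * (cmod (cinner b z))\<^sup>2" for z b
  \<comment> \<open>The limit of the values of the form of \<open>c - ln \<rho>\<^sub>0\<close> at
    the truncations, computed through the form of \<open>ln \<rho>\<close> and
    \<open>L\<close>.\<close>
  define V where "V = c * (norm x)\<^sup>2 - q + Re (cinner x (L x))"
  have h0: "h z b \<ge> 0" if "b \<in> ?B" for z b using c(1)[OF that] by (simp add: h_def)
  have c_sum: "((\<lambda>b. c * (cmod (cinner b z))\<^sup>2) has_sum c * (norm z)\<^sup>2) ?B" for z
    by (intro has_sum_cmult_right onb_parseval_norm eigenbasisD[OF B])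
  have off: "cinner a x = 0" if "a \<in> ?A - ?R" for a
    using cinner_some_eigenbasis_ocompl[OF x that] .
  have "((\<lambda>a. cinner a x *\<^sub>C a) has_sum x) ?R"
    using onb_expansion[OF eigenbasisD[OF A], of x]
    by (rule has_sum_cong_neutral[THEN iffD1, rotated -1])
       (use range_eigenbasis_subset[of \<rho>] off in \<open>auto simp: scaleC.zero_left\<close>)
  then have y_lim: "(y \<longlongrightarrow> x) (finite_subsets_at_top ?R)"
    by (simp add: has_sum_def y_def[abs_def])
  have q_lim: "(sum (\<lambda>a. ln (eigval \<rho> a) * (cmod (cinner a x))\<^sup>2) \<longlongrightarrow> q) (finite_subsets_at_top ?R)"
    unfolding has_sum_def[symmetric] using q
    by (rule has_sum_cong_neutral[THEN iffD1, rotated -1])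
       (use range_eigenbasis_subset[of \<rho>] off in auto)
  have y_form: "(h (y G) has_sum
      c * (norm (y G))\<^sup>2 - (\<Sum>a\<in>G. ln (eigval \<rho> a) * (cmod (cinner a x))\<^sup>2) + Re (cinner (y G) (L (y G)))) ?B"
    if G: "finite G" "G \<subseteq> ?R" for G
  proof -
    note yG = finite_sum_log_dom[OF \<rho>'(1) G, of "\<lambda>a. cinner a x", folded y_def]
    have "y G \<in> log_dom \<rho>\<^sub>0" and eq: "log_op \<rho> (y G) = log_op \<rho>\<^sub>0 (y G) + L (y G)"
      using L yG(1) by (auto simp: is_log_diff_def)
    note form = log_op_form_has_sum[OF \<rho>0'(1) this(1)]
    have "Re (cinner (y G) (log_op \<rho>\<^sub>0 (y G)))
        = (\<Sum>a\<in>G. ln (eigval \<rho> a) * (cmod (cinner a x))\<^sup>2) - Re (cinner (y G) (L (y G)))"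
      using yG(2) unfolding eq by (simp add: cinner_add_right)
    then have val: "c * (norm (y G))\<^sup>2 - (\<Sum>a\<in>G. ln (eigval \<rho> a) * (cmod (cinner a x))\<^sup>2)
        + Re (cinner (y G) (L (y G))) = c * (norm (y G))\<^sup>2 - Re (cinner (y G) (log_op \<rho>\<^sub>0 (y G)))"
      by simp
    show ?thesis
      unfolding val h_def left_diff_distrib by (rule has_sum_diff[OF c_sum form])
  qed
  \<comment> \<open>A Fatou argument: \<open>F\<close> stays fixed while \<open>G\<close> grows, and
    nonnegativity of \<open>h\<close> bounds the finite sum by the full form at each
    truncation.\<close>
  have bound: "sum (h x) F \<le> V" if F: "finite F" "F \<subseteq> ?B" for F
  proof (rule tendsto_le[of "finite_subsets_at_top ?R"])
    show "((\<lambda>G. sum (h (y G)) F) \<longlongrightarrow> sum (h x) F) (finite_subsets_at_top ?R)"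
      unfolding h_def
      by (intro tendsto_sum tendsto_mult tendsto_const tendsto_power tendsto_norm
          cinner.tendsto y_lim)
    show "((\<lambda>G. c * (norm (y G))\<^sup>2 - (\<Sum>a\<in>G. ln (eigval \<rho> a) * (cmod (cinner a x))\<^sup>2)
        + Re (cinner (y G) (L (y G)))) \<longlongrightarrow> V) (finite_subsets_at_top ?R)"
      unfolding V_def
      by (intro tendsto_intros q_lim cinner.tendsto y_lim bounded_linear.tendsto[OF bL])
    show "\<forall>\<^sub>F G in finite_subsets_at_top ?R. sum (h (y G)) F \<le>
        c * (norm (y G))\<^sup>2 - (\<Sum>a\<in>G. ln (eigval \<rho> a) * (cmod (cinner a x))\<^sup>2)
        + Re (cinner (y G) (L (y G)))"
      by (rule eventually_finite_subsets_at_top_weakI)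
         (rule finite_sum_le_has_sum[OF y_form F], auto intro: h0)
  qed simp
  have h_sum: "h x summable_on ?B"
    by (rule nonneg_bdd_above_summable_on) (auto intro!: bdd_aboveI2[of _ _ V] bound h0)
  have "infsum (h x) ?B \<le> V"
    by (rule infsum_le_finite_sums[OF h_sum bound])
  moreover have "((\<lambda>b. ln (eigval \<rho>\<^sub>0 b) * (cmod (cinner b x))\<^sup>2)
      has_sum c * (norm x)\<^sup>2 - infsum (h x) ?B) ?B"
    using has_sum_diff[OF c_sum[of x] has_sum_infsum[OF h_sum]]
    by (simp add: h_def algebra_simps)
  ultimately show ?thesis
    by (intro that[of "c * (norm x)\<^sup>2 - infsum (h x) ?B"]) (simp_all add: V_def)
qed

lemma log_form_diff:
  fixes \<rho> \<rho>\<^sub>0 :: "'a::chilbert_space \<Rightarrow> 'a"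
  assumes \<rho>: "\<rho> \<in> B1_pos" and \<rho>0: "\<rho>\<^sub>0 \<in> B1_pos" and L: "is_log_diff \<rho> \<rho>\<^sub>0 L"
    and x: "x \<in> ocompl (kernel \<rho>)"
    and q: "((\<lambda>a. ln (eigval \<rho> a) * (cmod (cinner a x))\<^sup>2) has_sum q) (some_eigenbasis \<rho>)"
  shows "((\<lambda>b. ln (eigval \<rho>\<^sub>0 b) * (cmod (cinner b x))\<^sup>2) has_sum q - Re (cinner x (L x)))
    (some_eigenbasis \<rho>\<^sub>0)"
proof -
  obtain q' where q': "((\<lambda>b. ln (eigval \<rho>\<^sub>0 b) * (cmod (cinner b x))\<^sup>2) has_sum q') (some_eigenbasis \<rho>\<^sub>0)"
    "q - Re (cinner x (L x)) \<le> q'"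
    using log_form_lower_bound[OF assms] by blast
  have "x \<in> ocompl (kernel \<rho>\<^sub>0)" using L x by (simp add: is_log_diff_def)
  then obtain q'' where q'': "((\<lambda>a. ln (eigval \<rho> a) * (cmod (cinner a x))\<^sup>2) has_sum q'') (some_eigenbasis \<rho>)"
    "q' - Re (cinner x (- L x)) \<le> q''"
    using log_form_lower_bound[OF \<rho>0 \<rho> is_log_diff_swap[OF L] _ q'(1)] by blast
  \<comment> \<open>Passing to the other logarithm and back returns the same sum, so neither
    inequality can be strict.\<close>
  have "q'' = q" by (rule has_sum_unique[OF q''(1) q])
  then have "q' = q - Re (cinner x (L x))"
    using q'(2) q''(2) by (simp add: cinner.minus_right)
  then show ?thesis using q'(1) by simp
qed

text \<open>Both operators vanish on the kernel, and the remaining eigenvectors of \<rho> lie in the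
  domain, where the identity determines the value. Boundedness extends agreement from the basis; the
  description operator in \<open>log_diff\<close> relies on this.\<close>

lemma is_log_diff_unique:
  fixes \<rho> \<rho>\<^sub>0 :: "'a::chilbert_space \<Rightarrow> 'a"
  assumes \<rho>: "\<rho> \<in> B1" and L: "is_log_diff \<rho> \<rho>\<^sub>0 L" and L': "is_log_diff \<rho> \<rho>\<^sub>0 L'"
  shows "L = L'"
proof
  fix x
  let ?A = "some_eigenbasis \<rho>"
  have A: "onb ?A" by (rule eigenbasisD[OF some_eigenbasis[OF \<rho>]])
  have "L a = L' a" if a: "a \<in> ?A" for a
  proof (cases "\<rho> a = 0")
    case True
    then have "a \<in> kernel \<rho>" by (simp add: kernel_def)
    then show ?thesis using L L' unfolding is_log_diff_def by metis
  next
    case False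
    then have "a \<in> log_dom \<rho>"
      using finite_sum_log_dom(1)[OF \<rho>, of "{a}" "\<lambda>_. 1"] a by (simp add: range_eigenbasis_def)
    then have "log_op \<rho>\<^sub>0 a + L a = log_op \<rho>\<^sub>0 a + L' a"
      using L L' unfolding is_log_diff_def by metis
    then show ?thesis by simp
  qed
  then have "((\<lambda>a. cinner a x *\<^sub>C L a) has_sum L' x) ?A"
    using bounded_clinear_expansion[of L', OF _ A, of x] L'
    by (simp add: is_log_diff_def bounded_selfadjoint_def cong: has_sum_cong)
  moreover have "((\<lambda>a. cinner a x *\<^sub>C L a) has_sum L x) ?A"
    using L by (intro bounded_clinear_expansion A) (simp add: is_log_diff_def bounded_selfadjoint_def)
  ultimately show "L x = L' x" using has_sum_unique by blast
qed

lemma is_log_diff_log_diff: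
  fixes \<rho> \<rho>\<^sub>0 :: "'a::chilbert_space \<Rightarrow> 'a"
  assumes "\<rho> \<in> B1" "log_diff_well_defined \<rho> \<rho>\<^sub>0"
  shows "is_log_diff \<rho> \<rho>\<^sub>0 (log_diff \<rho> \<rho>\<^sub>0)"
proof -
  obtain L where L: "is_log_diff \<rho> \<rho>\<^sub>0 L" using assms(2) by (auto simp: log_diff_well_defined_def)
  then have "log_diff \<rho> \<rho>\<^sub>0 = L"
    unfolding log_diff_def by (intro the_equality is_log_diff_unique[OF assms(1) _ L])
  then show ?thesis using L by simp
qed

section \<open>Change of the reference operator\<close>

text \<open>The summand of \<open>QKL_trace\<close> before conversion to \<open>ennreal\<close>, so
  that it can be split into signed parts.\<close>

definition entropy_term :: "('a::complex_inner \<Rightarrow> 'a) \<Rightarrow> ('a \<Rightarrow> 'a) \<Rightarrow> 'a \<times> 'a \<Rightarrow> real" where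
  "entropy_term \<sigma> T = (\<lambda>(s, a). (cmod (cinner s a))\<^sup>2 *
     (eigval T a - eigval \<sigma> s + eigval \<sigma> s * ln (eigval \<sigma> s) - eigval \<sigma> s * ln (eigval T a)))"

text \<open>The extended sum is the supremum of the finite sums; were it finite, it would bound them
  and force real summability.\<close>

lemma infsum_ennreal_eq:
  fixes f :: "'b \<Rightarrow> real"
  assumes "\<And>x. x \<in> A \<Longrightarrow> f x \<ge> 0"
  shows "(\<Sum>\<^sub>\<infinity>x\<in>A. ennreal (f x)) = (if f summable_on A then ennreal (infsum f A) else \<infinity>)"
proof -
  have sup: "(\<Sum>\<^sub>\<infinity>x\<in>A. ennreal (f x)) = (SUP F\<in>{F. finite F \<and> F \<subseteq> A}. ennreal (sum f F))"
    using assms by (subst nonneg_infsum_complete) (auto intro!: SUP_cong sum_ennreal)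
  show ?thesis
  proof (cases "f summable_on A")
    case True
    then show ?thesis using infsum_nonneg_is_SUPREMUM_ennreal[OF True assms] sup by simp
  next
    case False
    have "(\<Sum>\<^sub>\<infinity>x\<in>A. ennreal (f x)) = \<infinity>"
    proof (rule ccontr)
      assume "(\<Sum>\<^sub>\<infinity>x\<in>A. ennreal (f x)) \<noteq> \<infinity>"
      then obtain r where r: "r \<ge> 0" "(\<Sum>\<^sub>\<infinity>x\<in>A. ennreal (f x)) = ennreal r"
        by (metis ennreal_cases infinity_ennreal_def)
      have "sum f F \<le> r" if "finite F" "F \<subseteq> A" for F
      proof -
        have "ennreal (sum f F) \<le> ennreal r"
          unfolding r(2)[symmetric] sup using that by (intro SUP_upper) auto
        then show ?thesis using r(1) by simp
      qed
      then have "f summable_on A"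
        by (intro nonneg_bdd_above_summable_on assms bdd_aboveI2[of _ _ r]) auto
      then show False using False by blast
    qed
    then show ?thesis using False by simp
  qed
qed

text \<open>For positive \<open>l\<close> this is ln t <= t - 1 at t = m / l, multiplied by
  \<open>l\<close>.\<close>

lemma relative_entropy_integrand_nonneg:
  fixes l m :: real
  assumes "l \<ge> 0" "m > 0"
  shows "m - l + l * ln l - l * ln m \<ge> 0"
proof (cases "l = 0")
  case False
  then have l: "l > 0" using assms by simp
  have "l * ln (m / l) \<le> l * (m / l - 1)"
    using l assms by (intro mult_left_mono ln_le_minus_one) auto
  moreover have "l * (m / l - 1) = m - l" using l by (simp add: field_simps)
  moreover have "l * ln (m / l) = l * ln m - l * ln l"
    using l assms by (simp add: ln_div right_diff_distrib)
  ultimately show ?thesis by linarith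
qed (use assms in simp)

lemma kernel_ocompl_eigvec:
  assumes "bounded_selfadjoint \<sigma>" "kernel T \<subseteq> kernel \<sigma>" "\<sigma> s = l *\<^sub>R s" "l \<noteq> 0"
  shows "s \<in> ocompl (kernel T)"
  using eigvec_in_ocompl_kernel[OF assms(1,3,4)] assms(2) by (auto simp: ocompl_def)

text \<open>The only critical case is a zero eigenvalue of \<open>T\<close> against a nonzero one of
  \<sigma>; the kernel inclusion then makes the eigenvectors orthogonal, so the default value of
  \<open>ln 0\<close> is multiplied by zero.\<close>

lemma entropy_term_nonneg:
  fixes \<sigma> T :: "'a::chilbert_space \<Rightarrow> 'a"
  assumes \<sigma>: "\<sigma> \<in> B1_pos" and T: "T \<in> B1_pos" and ker: "kernel T \<subseteq> kernel \<sigma>"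
    and s: "s \<in> some_eigenbasis \<sigma>" and a: "a \<in> some_eigenbasis T"
  shows "entropy_term \<sigma> T (s, a) \<ge> 0"
proof -
  note \<sigma>' = B1_posD[OF \<sigma>] and T' = B1_posD[OF T]
  have l: "eigval \<sigma> s \<ge> 0" by (rule eigval_nonneg[OF \<sigma>'(2) some_eigenbasis[OF \<sigma>'(1)] s])
  have m: "eigval T a \<ge> 0" by (rule eigval_nonneg[OF T'(2) some_eigenbasis[OF T'(1)] a])
  show ?thesis
  proof (cases "eigval T a = 0 \<and> eigval \<sigma> s \<noteq> 0")
    case True
    then have "s \<in> ocompl (kernel T)"
      using kernel_ocompl_eigvec[OF \<sigma>'(3) ker eigval_eigenbasis[OF some_eigenbasis[OF \<sigma>'(1)] s]] by blast
    moreover have "a \<in> kernel T"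
      using eigval_eigenbasis[OF some_eigenbasis[OF T'(1)] a] True by (simp add: kernel_def)
    ultimately have "cinner a s = 0" by (simp add: ocompl_def)
    then show ?thesis by (simp add: entropy_term_def cmod_cinner_commute[of s a])
  next
    case False
    then have "eigval T a - eigval \<sigma> s + eigval \<sigma> s * ln (eigval \<sigma> s) - eigval \<sigma> s * ln (eigval T a) \<ge> 0"
      using m l relative_entropy_integrand_nonneg[of "eigval \<sigma> s" "eigval T a"] by force
    then show ?thesis by (simp add: entropy_term_def)
  qed
qed

lemma QKL_eq:
  fixes \<sigma> T :: "'a::chilbert_space \<Rightarrow> 'a"
  assumes "\<sigma> \<in> B1_pos" "T \<in> B1_pos" "kernel T \<subseteq> kernel \<sigma>"
  shows "QKL \<sigma> T = (if entropy_term \<sigma> T summable_on some_eigenbasis \<sigma> \<times> some_eigenbasis T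
    then ereal (infsum (entropy_term \<sigma> T) (some_eigenbasis \<sigma> \<times> some_eigenbasis T)) else \<infinity>)"
proof -
  have nn: "entropy_term \<sigma> T p \<ge> 0" if "p \<in> some_eigenbasis \<sigma> \<times> some_eigenbasis T" for p
    using entropy_term_nonneg[OF assms] that by auto
  have "QKL_trace \<sigma> T = (\<Sum>\<^sub>\<infinity>p\<in>some_eigenbasis \<sigma> \<times> some_eigenbasis T. ennreal (entropy_term \<sigma> T p))"
    unfolding QKL_trace_def entropy_term_def Let_def by (intro infsum_cong) auto
  also have "\<dots> = (if entropy_term \<sigma> T summable_on some_eigenbasis \<sigma> \<times> some_eigenbasis T
    then ennreal (infsum (entropy_term \<sigma> T) (some_eigenbasis \<sigma> \<times> some_eigenbasis T)) else \<infinity>)"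
    by (rule infsum_ennreal_eq) (rule nn)
  finally have tr: "QKL_trace \<sigma> T = \<dots>" .
  have "infsum (entropy_term \<sigma> T) (some_eigenbasis \<sigma> \<times> some_eigenbasis T) \<ge> 0"
    by (rule infsum_nonneg) (rule nn)
  then show ?thesis using assms by (simp add: QKL_def tr enn2ereal_ennreal)
qed

text \<open>Apart from the logarithm of the reference operator, all parts of a row converge
  separately. For a nonzero eigenvalue of \<sigma>, convergence of the row thus puts
  \<open>s\<close> in the form domain of \<open>ln \<rho>\<close>, and \<open>log_form_diff\<close>
  applies.\<close>

lemma entropy_row_change:
  fixes \<sigma> \<rho> \<rho>\<^sub>0 :: "'a::chilbert_space \<Rightarrow> 'a"
  assumes \<rho>: "\<rho> \<in> B1_pos" and \<rho>0: "\<rho>\<^sub>0 \<in> B1_pos" and L: "is_log_diff \<rho> \<rho>\<^sub>0 L"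
    and \<sigma>: "\<sigma> \<in> B1_pos" and ker: "kernel \<rho> \<subseteq> kernel \<sigma>" and s: "s \<in> some_eigenbasis \<sigma>"
    and g: "((\<lambda>a. entropy_term \<sigma> \<rho> (s, a)) has_sum g) (some_eigenbasis \<rho>)"
  shows "((\<lambda>b. entropy_term \<sigma> \<rho>\<^sub>0 (s, b)) has_sum
    g + (Re (cinner s (\<rho>\<^sub>0 s)) - Re (cinner s (\<rho> s)) + eigval \<sigma> s * Re (cinner s (L s))))
    (some_eigenbasis \<rho>\<^sub>0)"
proof -
  define l where "l = eigval \<sigma> s"
  \<comment> \<open>The row equation solved for the logarithmic part, still weighted by
    \<open>l\<close>.\<close>
  define q where "q = Re (cinner s (\<rho> s)) - (l - l * ln l) - g"
  note \<sigma>' = B1_posD[OF \<sigma>]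
  note S = some_eigenbasis[OF \<sigma>'(1)]
  have ns: "norm s = 1" by (rule orthonormal_norm[OF onb_orthonormal[OF eigenbasisD[OF S]] s])
  have basic: "((\<lambda>a. eigval T a * (cmod (cinner a s))\<^sup>2 - (l - l * ln l) * (cmod (cinner a s))\<^sup>2)
      has_sum Re (cinner s (T s)) - (l - l * ln l)) (some_eigenbasis T)"
    if "T \<in> B1_pos" for T :: "'a \<Rightarrow> 'a"
  proof -
    note T' = B1_posD[OF that]
    note A = some_eigenbasis[OF T'(1)]
    have "((\<lambda>a. eigval T a * (cmod (cinner a s))\<^sup>2 - (l - l * ln l) * (cmod (cinner a s))\<^sup>2)
      has_sum Re (cinner s (T s)) - (l - l * ln l) * (norm s)\<^sup>2) (some_eigenbasis T)"
      by (intro has_sum_diff has_sum_cmult_right onb_parseval_norm eigenbasisD[OF A]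
          selfadjoint_form_has_sum T' eigval_eigenbasis[OF A])
    then show ?thesis by (simp add: ns)
  qed
  have split: "entropy_term \<sigma> T (s, a) =
      eigval T a * (cmod (cinner a s))\<^sup>2 - (l - l * ln l) * (cmod (cinner a s))\<^sup>2
      - l * (ln (eigval T a) * (cmod (cinner a s))\<^sup>2)" for T :: "'a \<Rightarrow> 'a" and a
    by (simp add: entropy_term_def l_def cmod_cinner_commute[of s a] algebra_simps)
  have lq: "((\<lambda>a. l * (ln (eigval \<rho> a) * (cmod (cinner a s))\<^sup>2)) has_sum q) (some_eigenbasis \<rho>)"
    using has_sum_diff[OF basic[OF \<rho>] g] by (simp add: split q_def)
  have "((\<lambda>b. l * (ln (eigval \<rho>\<^sub>0 b) * (cmod (cinner b s))\<^sup>2)) has_sum q - l * Re (cinner s (L s)))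
      (some_eigenbasis \<rho>\<^sub>0)"
  \<comment> \<open>The weight must be divided out before the form identity can be used; when it is
    zero, both weighted series vanish.\<close>
  proof (cases "l = 0")
    case True
    then have "q = 0" using lq has_sum_unique[OF has_sum_0_simp] by force
    then show ?thesis using True by simp
  next
    case False
    have "s \<in> ocompl (kernel \<rho>)"
      using kernel_ocompl_eigvec[OF \<sigma>'(3) ker eigval_eigenbasis[OF S s]] False by (simp add: l_def)
    moreover have "((\<lambda>a. ln (eigval \<rho> a) * (cmod (cinner a s))\<^sup>2) has_sum q / l) (some_eigenbasis \<rho>)"
      using has_sum_cmult_right[OF lq, of "1 / l"] False by simp
    ultimately have "((\<lambda>b. ln (eigval \<rho>\<^sub>0 b) * (cmod (cinner b s))\<^sup>2) has_sum q / l - Re (cinner s (L s)))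
        (some_eigenbasis \<rho>\<^sub>0)"
      by (rule log_form_diff[OF \<rho> \<rho>0 L])
    from has_sum_cmult_right[OF this, of l] show ?thesis
      using False by (simp add: right_diff_distrib)
  qed
  from has_sum_diff[OF basic[OF \<rho>0] this] show ?thesis
    by (simp add: split q_def l_def algebra_simps)
qed

section \<open>Traces as sums of eigenvalues and weighted forms\<close>

lemma form_trace_has_sum:
  fixes \<sigma> :: "'a::chilbert_space \<Rightarrow> 'a"
  assumes "\<sigma> \<in> B1" "onb E"
  shows "((\<lambda>e. Re (cinner e (\<sigma> e))) has_sum (\<Sum>\<^sub>\<infinity>a\<in>some_eigenbasis \<sigma>. eigval \<sigma> a)) E"
proof -
  note A = some_eigenbasis[OF assms(1)]
  have id: "bounded_clinear (\<lambda>x::'a. x)" by (simp add: bounded_clinear_def bounded_linear_ident)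
  obtain t where t: "((\<lambda>a. eigval \<sigma> a * cinner a a) has_sum t) (some_eigenbasis \<sigma>)"
    "((\<lambda>e. cinner e (\<sigma> e)) has_sum t) E"
    using trace_class_product_has_sum[OF assms(1) A id assms(2)] by blast
  have "Re (eigval \<sigma> a * cinner a a) = eigval \<sigma> a" if "a \<in> some_eigenbasis \<sigma>" for a
    using orthonormal_norm[OF onb_orthonormal[OF eigenbasisD[OF A]] that] by (simp add: cinner_self)
  from has_sum_cong[THEN iffD1, OF this has_sum_Re[OF t(1)]]
  have "(eigval \<sigma> has_sum Re t) (some_eigenbasis \<sigma>)" .
  then show ?thesis using has_sum_Re[OF t(2)] infsumI by force
qed

text \<open>For \<sigma> in \<open>B1\<close> and bounded complex-linear \<open>L\<close>, this is
  the real part of the trace of \<open>L\<close> after \<sigma>, written in the eigenbasis that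
  indexes the entropy rows.\<close>

definition weighted_form :: "('a::complex_inner \<Rightarrow> 'a) \<Rightarrow> ('a \<Rightarrow> 'a) \<Rightarrow> real" where
  "weighted_form L \<sigma> = (\<Sum>\<^sub>\<infinity>s\<in>some_eigenbasis \<sigma>. eigval \<sigma> s * Re (cinner s (L s)))"

lemma weighted_form_has_sum:
  fixes \<sigma> :: "'a::chilbert_space \<Rightarrow> 'a"
  assumes \<sigma>: "\<sigma> \<in> B1" and L: "bounded_clinear L"
  shows "((\<lambda>s. eigval \<sigma> s * Re (cinner s (L s))) has_sum weighted_form L \<sigma>) (some_eigenbasis \<sigma>)"
    and "onb E \<Longrightarrow> ((\<lambda>e. Re (cinner e (L (\<sigma> e)))) has_sum weighted_form L \<sigma>) E"
proof -
  have *: "((\<lambda>s. eigval \<sigma> s * Re (cinner s (L s))) has_sum weighted_form L \<sigma>) (some_eigenbasis \<sigma>) \<and>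
    ((\<lambda>e. Re (cinner e (L (\<sigma> e)))) has_sum weighted_form L \<sigma>) E" if E: "onb E" for E
  proof -
    obtain t where t: "((\<lambda>s. eigval \<sigma> s * cinner s (L s)) has_sum t) (some_eigenbasis \<sigma>)"
      "((\<lambda>e. cinner e (L (\<sigma> e))) has_sum t) E"
      using trace_class_product_has_sum[OF \<sigma> some_eigenbasis[OF \<sigma>] L E] by blast
    have "((\<lambda>s. eigval \<sigma> s * Re (cinner s (L s))) has_sum Re t) (some_eigenbasis \<sigma>)"
      using has_sum_Re[OF t(1)] by simp
    moreover from this have "weighted_form L \<sigma> = Re t"
      unfolding weighted_form_def by (rule infsumI)
    ultimately show ?thesis using has_sum_Re[OF t(2)] by simp
  qed
  then show "((\<lambda>s. eigval \<sigma> s * Re (cinner s (L s))) has_sum weighted_form L \<sigma>) (some_eigenbasis \<sigma>)"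
    using eigenbasisD[OF some_eigenbasis[OF \<sigma>]] by blast
  show "((\<lambda>e. Re (cinner e (L (\<sigma> e)))) has_sum weighted_form L \<sigma>) E" if "onb E"
    using * that by blast
qed

text \<open>The difference need not be diagonalised: both traces are taken in the basis chosen by
  \<open>trace\<close> and subtracted term by term, then each is moved to its own
  eigenbasis.\<close>

lemma trace_pairing_diff:
  fixes \<sigma> \<rho> :: "'a::chilbert_space \<Rightarrow> 'a"
  assumes \<sigma>: "\<sigma> \<in> B1" and \<rho>: "\<rho> \<in> B1" and L: "bounded_clinear L"
  shows "trace_pairing L (\<lambda>x. \<sigma> x - \<rho> x) = weighted_form L \<sigma> - weighted_form L \<rho>"
proof -
  define E where "E = (SOME E :: 'a set. onb E)"
  have E: "onb E"
    unfolding E_def using eigenbasisD[OF some_eigenbasis[OF \<rho>]] by (rule someI[of onb])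
  obtain t u where tu: "((\<lambda>e. cinner e (L (\<sigma> e))) has_sum t) E" "((\<lambda>e. cinner e (L (\<rho> e))) has_sum u) E"
    using trace_class_product_has_sum[OF \<sigma> some_eigenbasis[OF \<sigma>] L E]
      trace_class_product_has_sum[OF \<rho> some_eigenbasis[OF \<rho>] L E] by blast
  have "linear L" using L by (simp add: bounded_clinear_def bounded_linear.linear)
  then have "((\<lambda>e. cinner e ((L \<circ> (\<lambda>x. \<sigma> x - \<rho> x)) e)) has_sum t - u) E"
    using has_sum_diff[OF tu] by (simp add: linear_diff cinner.diff_right)
  then have "trace (L \<circ> (\<lambda>x. \<sigma> x - \<rho> x)) = t - u"
    unfolding trace_def E_def[symmetric] by (rule infsumI)
  moreover have "Re t = weighted_form L \<sigma>"
    by (rule has_sum_unique[OF has_sum_Re[OF tu(1)] weighted_form_has_sum(2)[OF \<sigma> L E]])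
  moreover have "Re u = weighted_form L \<rho>"
    by (rule has_sum_unique[OF has_sum_Re[OF tu(2)] weighted_form_has_sum(2)[OF \<rho> L E]])
  ultimately show ?thesis by (simp add: trace_pairing_def)
qed

lemma entropy_change:
  fixes \<sigma> \<rho> \<rho>\<^sub>0 :: "'a::chilbert_space \<Rightarrow> 'a"
  assumes \<rho>: "\<rho> \<in> B1_pos" and \<rho>0: "\<rho>\<^sub>0 \<in> B1_pos" and L: "is_log_diff \<rho> \<rho>\<^sub>0 L"
    and \<sigma>: "\<sigma> \<in> B1_pos" and ker: "kernel \<rho> \<subseteq> kernel \<sigma>"
    and summ: "entropy_term \<sigma> \<rho> summable_on some_eigenbasis \<sigma> \<times> some_eigenbasis \<rho>"
  shows "(entropy_term \<sigma> \<rho>\<^sub>0 has_sum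
    infsum (entropy_term \<sigma> \<rho>) (some_eigenbasis \<sigma> \<times> some_eigenbasis \<rho>) +
    (infsum (eigval \<rho>\<^sub>0) (some_eigenbasis \<rho>\<^sub>0) - infsum (eigval \<rho>) (some_eigenbasis \<rho>) + weighted_form L \<sigma>))
    (some_eigenbasis \<sigma> \<times> some_eigenbasis \<rho>\<^sub>0)"
    (is "(_ has_sum ?total) _")
proof -
  let ?S = "some_eigenbasis \<sigma>"
  have S: "onb ?S" by (rule eigenbasisD[OF some_eigenbasis[OF B1_posD(1)[OF \<sigma>]]])
  have Lcl: "bounded_clinear L" using L by (simp add: is_log_diff_def bounded_selfadjoint_def)
  define g where "g s = infsum (\<lambda>a. entropy_term \<sigma> \<rho> (s, a)) (some_eigenbasis \<rho>)" for s
  define d where "d s = Re (cinner s (\<rho>\<^sub>0 s)) - Re (cinner s (\<rho> s)) + eigval \<sigma> s * Re (cinner s (L s))" for s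
  have row: "((\<lambda>a. entropy_term \<sigma> \<rho> (s, a)) has_sum g s) (some_eigenbasis \<rho>)" if "s \<in> ?S" for s
    unfolding g_def
    using summable_on_SigmaD1[of "\<lambda>s a. entropy_term \<sigma> \<rho> (s, a)" ?S "\<lambda>_. some_eigenbasis \<rho>" s] summ that
    by simp
  have "(g has_sum infsum (entropy_term \<sigma> \<rho>) (?S \<times> some_eigenbasis \<rho>)) ?S"
    by (rule has_sum_SigmaD[OF has_sum_infsum[OF summ] row])
  moreover have "(d has_sum infsum (eigval \<rho>\<^sub>0) (some_eigenbasis \<rho>\<^sub>0) - infsum (eigval \<rho>) (some_eigenbasis \<rho>)
      + weighted_form L \<sigma>) ?S"
    unfolding d_def
    by (intro has_sum_add has_sum_diff form_trace_has_sum weighted_form_has_sum(1) B1_posD(1) \<rho> \<rho>0 \<sigma> S Lcl)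
  ultimately have tot: "((\<lambda>s. g s + d s) has_sum ?total) ?S" by (rule has_sum_add)
  have row0: "((\<lambda>b. entropy_term \<sigma> \<rho>\<^sub>0 (s, b)) has_sum g s + d s) (some_eigenbasis \<rho>\<^sub>0)" if "s \<in> ?S" for s
    unfolding d_def by (rule entropy_row_change[OF \<rho> \<rho>0 L \<sigma> ker that row[OF that]])
  have ker0: "kernel \<rho>\<^sub>0 \<subseteq> kernel \<sigma>" using L ker by (simp add: is_log_diff_def)
  \<comment> \<open>Nonnegative terms let convergence of the row sums imply summability of the
    double family.\<close>
  have "entropy_term \<sigma> \<rho>\<^sub>0 summable_on ?S \<times> some_eigenbasis \<rho>\<^sub>0"
    by (rule summable_on_SigmaI[OF row0 has_sum_imp_summable[OF tot]])
       (use entropy_term_nonneg[OF \<sigma> \<rho>0 ker0] in auto)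
  then show ?thesis using has_sum_SigmaI[OF row0 tot] by blast
qed

lemma QKL_change:
  fixes \<sigma> \<rho> \<rho>\<^sub>0 :: "'a::chilbert_space \<Rightarrow> 'a"
  assumes \<rho>: "\<rho> \<in> B1_pos" and \<rho>0: "\<rho>\<^sub>0 \<in> B1_pos" and L: "is_log_diff \<rho> \<rho>\<^sub>0 L"
  shows "QKL \<sigma> \<rho>\<^sub>0 = QKL \<sigma> \<rho> + ereal (infsum (eigval \<rho>\<^sub>0) (some_eigenbasis \<rho>\<^sub>0)
    - infsum (eigval \<rho>) (some_eigenbasis \<rho>) + weighted_form L \<sigma>)"
proof (cases "\<sigma> \<in> B1_pos \<and> kernel \<rho> \<subseteq> kernel \<sigma>")
  case False
  then show ?thesis using L by (auto simp: QKL_def is_log_diff_def)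
next
  case True
  then have \<sigma>: "\<sigma> \<in> B1_pos" and ker: "kernel \<rho> \<subseteq> kernel \<sigma>" by auto
  have ker0: "kernel \<rho>\<^sub>0 \<subseteq> kernel \<sigma>" using L ker by (simp add: is_log_diff_def)
  let ?f = "entropy_term \<sigma> \<rho>" and ?g = "entropy_term \<sigma> \<rho>\<^sub>0"
  let ?X = "some_eigenbasis \<sigma> \<times> some_eigenbasis \<rho>" and ?Y = "some_eigenbasis \<sigma> \<times> some_eigenbasis \<rho>\<^sub>0"
  show ?thesis
  proof (cases "?f summable_on ?X")
    case True
    note * = entropy_change[OF \<rho> \<rho>0 L \<sigma> ker True]
    show ?thesis
      unfolding QKL_eq[OF \<sigma> \<rho> ker] QKL_eq[OF \<sigma> \<rho>0 ker0]
      using True has_sum_imp_summable[OF *] infsumI[OF *] by simp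
  next
    case False
    \<comment> \<open>The finite case with the two reference operators exchanged excludes that only
      one side is infinite.\<close>
    then have "\<not> ?g summable_on ?Y"
      using entropy_change[OF \<rho>0 \<rho> is_log_diff_swap[OF L] \<sigma> ker0] has_sum_imp_summable by blast
    then show ?thesis using False unfolding QKL_eq[OF \<sigma> \<rho> ker] QKL_eq[OF \<sigma> \<rho>0 ker0] by simp
  qed
qed

text \<open>Both sums run over the same chosen eigenbasis: off-diagonal terms vanish by
  orthogonality, diagonal ones by cancellation.\<close>

lemma QKL_self:
  fixes \<rho> :: "'a::chilbert_space \<Rightarrow> 'a"
  assumes "\<rho> \<in> B1_pos"
  shows "QKL \<rho> \<rho> = 0"
proof -
  have on: "orthonormal (some_eigenbasis \<rho>)"
    by (rule onb_orthonormal[OF eigenbasisD[OF some_eigenbasis[OF B1_posD(1)[OF assms]]]])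
  have "entropy_term \<rho> \<rho> (a, b) = 0" if "a \<in> some_eigenbasis \<rho>" "b \<in> some_eigenbasis \<rho>" for a b
  proof (cases "a = b")
    case False
    then have "cinner a b = 0" using on that unfolding orthonormal_def by metis
    then show ?thesis by (simp add: entropy_term_def)
  qed (simp add: entropy_term_def)
  then have "(entropy_term \<rho> \<rho> has_sum 0) (some_eigenbasis \<rho> \<times> some_eigenbasis \<rho>)"
    by (intro has_sum_0) auto
  then show ?thesis
    unfolding QKL_eq[OF assms assms subset_refl] by (auto simp: has_sum_iff)
qed

lemma QKL_nonneg: "QKL \<sigma> T \<ge> 0"
  by (simp add: QKL_def)

theorem corollary2p11:
  fixes \<rho> \<rho>\<^sub>0 :: "'a::chilbert_space \<Rightarrow> 'a"
  assumes "separable_space (euclidean :: 'a topology)"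
    and "\<rho>\<^sub>0 \<in> B1_pos" and "\<rho> \<in> B1_pos"
    and "log_diff_well_defined \<rho> \<rho>\<^sub>0"
  shows "log_diff \<rho> \<rho>\<^sub>0 \<in> subdifferential (\<lambda>\<tau>. QKL \<tau> \<rho>\<^sub>0) \<rho> \<and>
    (\<forall>\<sigma>\<in>B1. bregman (\<lambda>\<tau>. QKL \<tau> \<rho>\<^sub>0) (log_diff \<rho> \<rho>\<^sub>0) \<sigma> \<rho> = QKL \<sigma> \<rho>)"
proof -
  note \<rho>0 = assms(2) and \<rho> = assms(3)
  define L where "L = log_diff \<rho> \<rho>\<^sub>0"
  have L: "is_log_diff \<rho> \<rho>\<^sub>0 L"
    unfolding L_def by (rule is_log_diff_log_diff[OF B1_posD(1)[OF \<rho>] assms(4)])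
  then have Lsa: "bounded_selfadjoint L" by (simp add: is_log_diff_def)
  then have Lcl: "bounded_clinear L" by (simp add: bounded_selfadjoint_def)
  \<comment> \<open>The difference of the two traces; it does not depend on \<sigma> and cancels in
    the divergence.\<close>
  define D where "D = infsum (eigval \<rho>\<^sub>0) (some_eigenbasis \<rho>\<^sub>0) - infsum (eigval \<rho>) (some_eigenbasis \<rho>)"
  have change: "QKL \<sigma> \<rho>\<^sub>0 = QKL \<sigma> \<rho> + ereal (D + weighted_form L \<sigma>)" for \<sigma>
    unfolding D_def by (rule QKL_change[OF \<rho> \<rho>0 L])
  \<comment> \<open>Finiteness at \<rho> makes the extended-real subtractions meaningful, even where
    the entropy of \<sigma> is infinite.\<close>
  have at_\<rho>: "QKL \<rho> \<rho>\<^sub>0 = ereal (D + weighted_form L \<rho>)"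
    unfolding change QKL_self[OF \<rho>] by simp
  have pairing: "trace_pairing L (\<lambda>x. \<sigma> x - \<rho> x) = weighted_form L \<sigma> - weighted_form L \<rho>"
    if "\<sigma> \<in> B1" for \<sigma>
    by (rule trace_pairing_diff[OF that B1_posD(1)[OF \<rho>] Lcl])
  have "QKL \<rho> \<rho>\<^sub>0 + ereal (trace_pairing L (\<lambda>x. \<sigma> x - \<rho> x)) \<le> QKL \<sigma> \<rho>\<^sub>0" if "\<sigma> \<in> B1" for \<sigma>
    unfolding pairing[OF that] at_\<rho> unfolding change[of \<sigma>]
    using QKL_nonneg[of \<sigma> \<rho>] by (cases "QKL \<sigma> \<rho>") auto
  moreover have "QKL \<sigma> \<rho>\<^sub>0 - QKL \<rho> \<rho>\<^sub>0 - ereal (trace_pairing L (\<lambda>x. \<sigma> x - \<rho> x)) = QKL \<sigma> \<rho>"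
    if "\<sigma> \<in> B1" for \<sigma>
    unfolding pairing[OF that] at_\<rho> unfolding change[of \<sigma>]
    using QKL_nonneg[of \<sigma> \<rho>] by (cases "QKL \<sigma> \<rho>") auto
  ultimately show ?thesis
    using Lsa B1_posD(1)[OF \<rho>] at_\<rho> unfolding L_def[symmetric]
    by (simp add: subdifferential_def bregman_def)
qed

end
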